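(* Let $(\mathcal{N},\mathcal{E})$ be any weakly-cyclic network (a graph in which no edge belongs to more than one cycle). Then for every $\varepsilon>0$ there exist a demand profile $\bm{d}$, a set of generators $\mathcal{N}_g\subseteq\mathcal{N}$, cost functions $\{c_n\}_{n\in\mathcal{N}_g}$, generator capacity limits $\{\underline{s}_n,\bar{s}_n\}_{n\in\mathcal{N}_g}$, flow limits $\{f_{nm}\}_{nm\in\mathcal{E}}$ and admittances $\{B_{nm}\}_{nm\in\mathcal{E}}$ such that, for the resulting electricity market (as described in the context), with $$U:=1+\max_{n\in\mathcal{N}_g}\frac{\min\left\{\bar{s}_n,\ D-\sum_{m\in\mathcal{N}_g,\,m\neq n}\underline{s}_m,\ d_n+\sum_{m\in\mathcal{N}(n)}\hat{f}_{nm}\right\}}{(|\mathcal{N}_g|-2)D}$$ denoting the upper bound of the price of anarchy, the following hold: 1. $\displaystyle U=1+\max_{n\in\mathcal{N}_g}\frac{d_n+\sum_{m\in\mathcal{N}(n)}\hat{f}_{nm}}{(|\mathcal{N}_g|-2)D}$; 2. the difference between the actual price of anarchy and the upper bound is within $\varepsilon$, i.e. $|U-\mathrm{PoA}|\le\varepsilon$.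
   Context: Network. $(\mathcal{N},\mathcal{E})$ is a finite connected simple graph with at least three nodes (nodes are buses, edges are transmission lines); $\mathcal{N}(n)$ is the set of neighbors of node $n$. $\mathcal{N}_g\subseteq\mathcal{N}$ is the set of buses having a generator (each owned by a different supplier), with $|\mathcal{N}_g|>2$. Bus $j$ has an inelastic load $d_j\ge 0$; $\bm{d}=(d_j)_{j\in\mathcal{N}}$ and $D=\sum_{j\in\mathcal{N}}d_j>0$. Line $\{i,j\}$ has admittance $B_{ij}=B_{ji}>0$ and flow limit $f_{ij}=f_{ji}\ge 0$; $\bm{f}$ is the vector of flow limits. Line flows (linearized power flow model). Fix an orientation of each edge. If $\sum_{n\in\mathcal{N}_g}s_n=D$, the line flows $(p_{ij})$, with $p_{ij}=-p_{ji}$ the flow from $i$ to $j$, are the unique ones for which there are voltage angles $(\theta_i)$ with $p_{ij}=B_{ij}(\theta_i-\theta_j)$ on each edge, and for which, at each bus $m$, $\sum_{i\in\mathcal{N}(m)}p_{mi}$ equals the net injection ($s_m-d_m$ if $m\in\mathcal{N}_g$, $-d_m$ otherwise). The shift-factor matrices $\mathbf{A}_g\in\mathbb{R}^{|\mathcal{E}|\times|\mathcal{N}_g|}$ and $\mathbf{A}_\ell\in\mathbb{R}^{|\mathcal{E}|\times|\mathcal{N}|}$ are matrices such that the vector of line flows is $\mathbf{A}_g\bm{s}+\mathbf{A}_\ell\bm{d}$. $[\mathbf{A}]_{*n}$ denotes the $n$th column of a matrix $\mathbf{A}$. Standing assumptions. (1) For each $n\in\mathcal{N}_g$, the cost function $c_n:[0,\infty)\to[0,\infty)$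 is convex, strictly increasing and differentiable. (2) Supplies satisfy $\underline{s}_n\le s_n\le\bar{s}_n$, where $0\le\underline{s}_n\le\bar{s}_n$, and $\sum_{m\in\mathcal{N}_g,\,m\ne n}\bar{s}_m>D$ for all $n\in\mathcal{N}_g$. (3) There is a supply profile $\bm{s}$ with $\sum_n s_n=D$ that satisfies $\underline{s}_n\le s_n\le\bar{s}_n$ (for all $n\in\mathcal{N}_g$) and $-\bm{f}\le\mathbf{A}_g\bm{s}+\mathbf{A}_\ell\bm{d}\le\bm{f}$ with all inequalities strict. Social optimum. $\bm{s}^*=(s_n^* )_{n\in\mathcal{N}_g}$ is a minimizer of $\sum_{n\in\mathcal{N}_g}c_n(s_n)$ subject to $\sum_{n\in\mathcal{N}_g}s_n=D$, $\underline{s}_n\le s_n\le\bar{s}_n$ for all $n\in\mathcal{N}_g$, and $-\bm{f}\le\mathbf{A}_g\bm{s}+\mathbf{A}_\ell\bm{d}\le\bm{f}$. Supply function bidding. Each supplier $n\in\mathcal{N}_g$ chooses an action $w_n\ge 0$ and submits the supply function $S_n(p,w_n)=D-w_n/p$. For an action profile $\bm{w}=(w_n)_{n\in\mathcal{N}_g}$ with $\sum_n w_n>0$ the market-clearing price is $p(\bm{w})=\frac{\sum_{n\in\mathcal{N}_g}w_n}{(|\mathcal{N}_g|-1)D}$ (so that $\sum_n S_n[p(\bm{w}),w_n]=D$); the all-zero profile is regarded as infeasible. Supplier $n$'s profit is $u_n(w_n,\bm{w}_{-n})=p(\bm{w})\,S_n[p(\bm{w}),w_n]-c_n(S_n[p(\bm{w}),w_n])$,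 where $\bm{w}_{-n}$ denotes the actions of the other suppliers. SFE. An action profile $\bm{w}^{**}$ is a supply function equilibrium if for each $n\in\mathcal{N}_g$, $w_n^{**}$ solves: maximize $u_n(w_n,\bm{w}_{-n}^{**})$ over $w_n\ge 0$ subject to $\underline{s}_n\le S_n[p(w_n,\bm{w}_{-n}^{**}),w_n]\le\bar{s}_n$ and $$-\bm{f}\le\mathbf{A}_\ell\bm{d}+[\mathbf{A}_g]_{*n}S_n[p(w_n,\bm{w}_{-n}^{**}),w_n]+\sum_{m\in\mathcal{N}_g,\,m\ne n}[\mathbf{A}_g]_{*m}S_m[p(w_n,\bm{w}_{-n}^{**}),w_m^{**}]\le\bm{f}.$$ The equilibrium supply profile is $\bm{s}^{**}$ with $s_n^{**}=S_n[p(\bm{w}^{**}),w_n^{**}]$ for an SFE $\bm{w}^{**}$. (The paper states as a separate result that an SFE exists and that all SFEs give the same supply profile, so the PoA is well defined.) Price of anarchy. $\mathrm{PoA}=\sum_{n\in\mathcal{N}_g}c_n(s_n^{**})\big/\sum_{n\in\mathcal{N}_g}c_n(s_n^{*})$. Cycles, partitions, effective flow limits. A cycle is a sequence $n_1,\dots,n_k,n_1$ ($k\ge3$) with $n_1,\dots,n_k$ distinct nodes, consecutive nodes adjacent, and $n_k$ adjacent to $n_1$. For $n\in\mathcal{N}_g$, a partition $\mathcal{P}(n)$ of $\mathcal{N}(n)$ is a set of singletons and two-element subsets (duples) of $\mathcal{N}(n)$ such that: (i) the sets are mutually disjoint with union $\mathcal{N}(n)$; (ii) for every duple $\{i,j\}\in\mathcal{P}(n)$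 there is a cycle in which $i,n,j$ (or $j,n,i$) appear consecutively; (iii) for any two distinct singletons $\{i\},\{j\}\in\mathcal{P}(n)$, $i$ and $j$ are not in the same cycle. The mapping $\mathcal{C}_n$ assigns to each duple $\{i,j\}\in\mathcal{P}(n)$ one such cycle containing $i,n,j$ consecutively. One partition and one mapping are fixed (arbitrarily) for each $n\in\mathcal{N}_g$. The effective flow limit from $n$ to $m\in\mathcal{N}(n)$ is $\hat{f}_{nm}=f_{nm}$ if $\{m\}\in\mathcal{P}(n)$, and, if $\{m,i\}\in\mathcal{P}(n)$ is a duple, $$\hat{f}_{nm}=\min\left\{f_{nm},\ \left(\sum_{\{j,k\}}\frac{f_{jk}}{B_{jk}}\right)B_{nm}\right\},$$ where the sum is over all edges $\{j,k\}\ne\{n,m\}$ of the cycle $\mathcal{C}_n(\{m,i\})$. *)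

theory Defs
  imports "HOL-Analysis.Analysis"
begin

section \<open>Networks and cycles\<close>

text \<open>Nodes form a set \<open>N\<close>; an edge between \<open>i\<close> and \<open>j\<close> is the two-element set \<open>{i, j}\<close>, so that
  data indexed by edges are automatically symmetric.\<close>

definition simple_graph :: "'v set \<Rightarrow> 'v set set \<Rightarrow> bool" where
  "simple_graph N E \<longleftrightarrow> finite N \<and> E \<subseteq> {{i, j} | i j. i \<in> N \<and> j \<in> N \<and> i \<noteq> j}"

definition connected_graph :: "'v set \<Rightarrow> 'v set set \<Rightarrow> bool" where
  "connected_graph N E \<longleftrightarrow> (\<forall>i\<in>N. \<forall>j\<in>N. (i, j) \<in> {(a, b). {a, b} \<in> E}\<^sup>*)"

definition network :: "'v set \<Rightarrow> 'v set set \<Rightarrow> bool" where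
  "network N E \<longleftrightarrow> simple_graph N E \<and> connected_graph N E \<and> card N \<ge> 3"

definition neighbors :: "'v set set \<Rightarrow> 'v \<Rightarrow> 'v set" where
  "neighbors E n = {m. {n, m} \<in> E}"

text \<open>A cycle \<open>n\<^sub>1, \<dots>, n\<^sub>k, n\<^sub>1\<close> is represented by the list \<open>[n\<^sub>1, \<dots>, n\<^sub>k]\<close>; positions in it are
  read modulo \<open>k\<close>.\<close>

definition cycle_edges :: "'v list \<Rightarrow> 'v set set" where
  "cycle_edges xs = {{xs ! t, xs ! (Suc t mod length xs)} | t. t < length xs}"

definition is_cycle :: "'v set set \<Rightarrow> 'v list \<Rightarrow> bool" where
  "is_cycle E xs \<longleftrightarrow> length xs \<ge> 3 \<and> distinct xs \<and> cycle_edges xs \<subseteq> E"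

definition consecutive_in :: "'v list \<Rightarrow> 'v \<Rightarrow> 'v \<Rightarrow> 'v \<Rightarrow> bool" where
  "consecutive_in xs i n j \<longleftrightarrow>
     (\<exists>t<length xs. xs ! t = i \<and> xs ! ((t + 1) mod length xs) = n
        \<and> xs ! ((t + 2) mod length xs) = j)"

definition cycle_through :: "'v set set \<Rightarrow> 'v \<Rightarrow> 'v set \<Rightarrow> 'v list \<Rightarrow> bool" where
  "cycle_through E n X xs \<longleftrightarrow>
     is_cycle E xs \<and> (\<exists>i j. i \<noteq> j \<and> X = {i, j} \<and> consecutive_in xs i n j)"

text \<open>Sequences that differ only by their starting point or direction are the same cycle; they
  are identified through their edge sets.\<close>

definition weakly_cyclic :: "'v set set \<Rightarrow> bool" where
  "weakly_cyclic E \<longleftrightarrow>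
     (\<forall>e xs ys. is_cycle E xs \<and> is_cycle E ys \<and> e \<in> cycle_edges xs \<and> e \<in> cycle_edges ys
        \<longrightarrow> cycle_edges xs = cycle_edges ys)"

definition neighbor_partition :: "'v set set \<Rightarrow> 'v \<Rightarrow> 'v set set \<Rightarrow> bool" where
  "neighbor_partition E n P \<longleftrightarrow>
     partition_on (neighbors E n) P \<and>
     (\<forall>X\<in>P. card X = 1 \<or> card X = 2) \<and>
     (\<forall>X\<in>P. card X = 2 \<longrightarrow> (\<exists>xs. cycle_through E n X xs)) \<and>
     (\<forall>i j. i \<noteq> j \<and> {i} \<in> P \<and> {j} \<in> P \<longrightarrow>
        \<not> (\<exists>xs. is_cycle E xs \<and> i \<in> set xs \<and> j \<in> set xs))"

definition cycle_mapping :: "'v set set \<Rightarrow> 'v \<Rightarrow> 'v set set \<Rightarrow> ('v set \<Rightarrow> 'v list) \<Rightarrow> bool" where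
  "cycle_mapping E n P C \<longleftrightarrow> (\<forall>X\<in>P. card X = 2 \<longrightarrow> cycle_through E n X (C X))"


section \<open>Electricity markets\<close>

record 'v market =
  buses :: "'v set"
  lines :: "'v set set"
  gens :: "'v set"
  load :: "'v \<Rightarrow> real"
  cost :: "'v \<Rightarrow> real \<Rightarrow> real"
  smin :: "'v \<Rightarrow> real"
  smax :: "'v \<Rightarrow> real"
  flim :: "'v set \<Rightarrow> real"
  adm :: "'v set \<Rightarrow> real"

definition demand :: "'v market \<Rightarrow> real" where
  "demand M = (\<Sum>j\<in>buses M. load M j)"

definition valid_cost :: "(real \<Rightarrow> real) \<Rightarrow> bool" where
  "valid_cost c \<longleftrightarrow> (\<forall>x\<ge>0. c x \<ge> 0) \<and> convex_on {0..} c \<and> strict_mono_on {0..} c \<and>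
     c differentiable_on {0..}"

text \<open>All standing assumptions except strict feasibility, which refers to the shift factors.\<close>

definition valid_market :: "'v market \<Rightarrow> bool" where
  "valid_market M \<longleftrightarrow>
     network (buses M) (lines M) \<and>
     gens M \<subseteq> buses M \<and> card (gens M) > 2 \<and>
     (\<forall>j\<in>buses M. load M j \<ge> 0) \<and> demand M > 0 \<and>
     (\<forall>e\<in>lines M. adm M e > 0 \<and> flim M e \<ge> 0) \<and>
     (\<forall>n\<in>gens M. valid_cost (cost M n)) \<and>
     (\<forall>n\<in>gens M. 0 \<le> smin M n \<and> smin M n \<le> smax M n) \<and>
     (\<forall>n\<in>gens M. (\<Sum>m\<in>gens M - {n}. smax M m) > demand M)"

text \<open>The orientation \<open>ori\<close> lists the endpoints of every line in its reference direction. A vector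
  \<open>p\<close> of line flows is indexed by lines, with flow in the reference direction counted positively.\<close>

definition orientation :: "'v set set \<Rightarrow> ('v set \<Rightarrow> 'v \<times> 'v) \<Rightarrow> bool" where
  "orientation E ori \<longleftrightarrow> (\<forall>e\<in>E. e = {fst (ori e), snd (ori e)})"

definition flow_from_to :: "('v set \<Rightarrow> 'v \<times> 'v) \<Rightarrow> ('v set \<Rightarrow> real) \<Rightarrow> 'v \<Rightarrow> 'v \<Rightarrow> real" where
  "flow_from_to ori p i j = (if ori {i, j} = (i, j) then p {i, j} else - p {i, j})"

definition line_flows ::
  "'v market \<Rightarrow> ('v set \<Rightarrow> 'v \<times> 'v) \<Rightarrow> ('v \<Rightarrow> real) \<Rightarrow> ('v \<Rightarrow> real) \<Rightarrow> ('v set \<Rightarrow> real) \<Rightarrow> bool" where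
  "line_flows M ori s d p \<longleftrightarrow>
     (\<exists>\<theta>. \<forall>i j. {i, j} \<in> lines M \<longrightarrow> flow_from_to ori p i j = adm M {i, j} * (\<theta> i - \<theta> j)) \<and>
     (\<forall>m\<in>buses M. (\<Sum>i\<in>neighbors (lines M) m. flow_from_to ori p m i)
        = (if m \<in> gens M then s m - d m else - d m))"

definition grid_flow ::
  "'v market \<Rightarrow> ('v set \<Rightarrow> 'v \<Rightarrow> real) \<Rightarrow> ('v set \<Rightarrow> 'v \<Rightarrow> real) \<Rightarrow> ('v \<Rightarrow> real) \<Rightarrow> ('v \<Rightarrow> real)
     \<Rightarrow> 'v set \<Rightarrow> real" where
  "grid_flow M Ag Al s d e = (\<Sum>n\<in>gens M. Ag e n * s n) + (\<Sum>m\<in>buses M. Al e m * d m)"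

text \<open>The matrices are properties of the grid and the generator locations, so the defining
  equation is required for every balanced pair of a supply and a demand profile.\<close>

definition shift_factors ::
  "'v market \<Rightarrow> ('v set \<Rightarrow> 'v \<times> 'v) \<Rightarrow> ('v set \<Rightarrow> 'v \<Rightarrow> real) \<Rightarrow> ('v set \<Rightarrow> 'v \<Rightarrow> real) \<Rightarrow> bool"
  where
  "shift_factors M ori Ag Al \<longleftrightarrow>
     (\<forall>s d. (\<Sum>n\<in>gens M. s n) = (\<Sum>m\<in>buses M. d m) \<longrightarrow>
        line_flows M ori s d (grid_flow M Ag Al s d))"

definition within_flow_limits ::
  "'v market \<Rightarrow> ('v set \<Rightarrow> 'v \<Rightarrow> real) \<Rightarrow> ('v set \<Rightarrow> 'v \<Rightarrow> real) \<Rightarrow> ('v \<Rightarrow> real) \<Rightarrow> bool" where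
  "within_flow_limits M Ag Al s \<longleftrightarrow>
     (\<forall>e\<in>lines M. - flim M e \<le> grid_flow M Ag Al s (load M) e \<and>
        grid_flow M Ag Al s (load M) e \<le> flim M e)"

definition strictly_feasible ::
  "'v market \<Rightarrow> ('v set \<Rightarrow> 'v \<Rightarrow> real) \<Rightarrow> ('v set \<Rightarrow> 'v \<Rightarrow> real) \<Rightarrow> bool" where
  "strictly_feasible M Ag Al \<longleftrightarrow>
     (\<exists>s. (\<Sum>n\<in>gens M. s n) = demand M \<and>
        (\<forall>n\<in>gens M. smin M n < s n \<and> s n < smax M n) \<and>
        (\<forall>e\<in>lines M. - flim M e < grid_flow M Ag Al s (load M) e \<and>
           grid_flow M Ag Al s (load M) e < flim M e))"

definition total_cost :: "'v market \<Rightarrow> ('v \<Rightarrow> real) \<Rightarrow> real" where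
  "total_cost M s = (\<Sum>n\<in>gens M. cost M n (s n))"

definition social_optimum ::
  "'v market \<Rightarrow> ('v set \<Rightarrow> 'v \<Rightarrow> real) \<Rightarrow> ('v set \<Rightarrow> 'v \<Rightarrow> real) \<Rightarrow> ('v \<Rightarrow> real) \<Rightarrow> bool" where
  "social_optimum M Ag Al s \<longleftrightarrow>
     is_arg_min (total_cost M)
       (\<lambda>s. (\<Sum>n\<in>gens M. s n) = demand M \<and>
          (\<forall>n\<in>gens M. smin M n \<le> s n \<and> s n \<le> smax M n) \<and>
          within_flow_limits M Ag Al s) s"


section \<open>Supply function equilibria and the price of anarchy\<close>

definition supply_fun :: "'v market \<Rightarrow> real \<Rightarrow> real \<Rightarrow> real" where
  "supply_fun M p wn = demand M - wn / p"

definition price :: "'v market \<Rightarrow> ('v \<Rightarrow> real) \<Rightarrow> real" where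
  "price M w = (\<Sum>n\<in>gens M. w n) / ((real (card (gens M)) - 1) * demand M)"

definition supply_profile :: "'v market \<Rightarrow> ('v \<Rightarrow> real) \<Rightarrow> 'v \<Rightarrow> real" where
  "supply_profile M w n = supply_fun M (price M w) (w n)"

definition profit :: "'v market \<Rightarrow> ('v \<Rightarrow> real) \<Rightarrow> 'v \<Rightarrow> real" where
  "profit M w n = price M w * supply_profile M w n - cost M n (supply_profile M w n)"

text \<open>Supplier \<open>n\<close> can play \<open>x\<close> against the actions of the others in \<open>w\<close>. Only the capacity limits
  of \<open>n\<close> itself are imposed, but the supplies of all suppliers change with the price.\<close>

definition feasible_action ::
  "'v market \<Rightarrow> ('v set \<Rightarrow> 'v \<Rightarrow> real) \<Rightarrow> ('v set \<Rightarrow> 'v \<Rightarrow> real) \<Rightarrow> ('v \<Rightarrow> real) \<Rightarrow> 'v \<Rightarrow> real \<Rightarrow> bool"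
  where
  "feasible_action M Ag Al w n x \<longleftrightarrow>
     x \<ge> 0 \<and> (\<Sum>m\<in>gens M. (w(n := x)) m) > 0 \<and>
     smin M n \<le> supply_profile M (w(n := x)) n \<and> supply_profile M (w(n := x)) n \<le> smax M n \<and>
     within_flow_limits M Ag Al (supply_profile M (w(n := x)))"

definition supply_function_equilibrium ::
  "'v market \<Rightarrow> ('v set \<Rightarrow> 'v \<Rightarrow> real) \<Rightarrow> ('v set \<Rightarrow> 'v \<Rightarrow> real) \<Rightarrow> ('v \<Rightarrow> real) \<Rightarrow> bool" where
  "supply_function_equilibrium M Ag Al w \<longleftrightarrow>
     (\<forall>n\<in>gens M.
        is_arg_max (\<lambda>x. profit M (w(n := x)) n) (feasible_action M Ag Al w n) (w n))"

definition is_price_of_anarchy ::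
  "'v market \<Rightarrow> ('v set \<Rightarrow> 'v \<Rightarrow> real) \<Rightarrow> ('v set \<Rightarrow> 'v \<Rightarrow> real) \<Rightarrow> real \<Rightarrow> bool" where
  "is_price_of_anarchy M Ag Al r \<longleftrightarrow>
     (\<exists>w s. supply_function_equilibrium M Ag Al w \<and> social_optimum M Ag Al s \<and>
        r = total_cost M (supply_profile M w) / total_cost M s)"

text \<open>\<open>P\<close> and \<open>C\<close> assign to every generator bus a partition of its neighbors and a choice of a
  cycle for every two-element block.\<close>

definition partition_choice ::
  "'v market \<Rightarrow> ('v \<Rightarrow> 'v set set) \<Rightarrow> ('v \<Rightarrow> 'v set \<Rightarrow> 'v list) \<Rightarrow> bool" where
  "partition_choice M P C \<longleftrightarrow>
     (\<forall>n\<in>gens M. neighbor_partition (lines M) n (P n) \<and> cycle_mapping (lines M) n (P n) (C n))"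

definition eff_flim ::
  "'v market \<Rightarrow> ('v \<Rightarrow> 'v set set) \<Rightarrow> ('v \<Rightarrow> 'v set \<Rightarrow> 'v list) \<Rightarrow> 'v \<Rightarrow> 'v \<Rightarrow> real" where
  "eff_flim M P C n m =
     (if {m} \<in> P n then flim M {n, m}
      else min (flim M {n, m})
        ((\<Sum>e \<in> cycle_edges (C n (THE X. X \<in> P n \<and> m \<in> X)) - {{n, m}}. flim M e / adm M e)
          * adm M {n, m}))"

definition export_bound ::
  "'v market \<Rightarrow> ('v \<Rightarrow> 'v set set) \<Rightarrow> ('v \<Rightarrow> 'v set \<Rightarrow> 'v list) \<Rightarrow> 'v \<Rightarrow> real" where
  "export_bound M P C n = load M n + (\<Sum>m\<in>neighbors (lines M) n. eff_flim M P C n m)"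

definition poa_bound ::
  "'v market \<Rightarrow> ('v \<Rightarrow> 'v set set) \<Rightarrow> ('v \<Rightarrow> 'v set \<Rightarrow> 'v list) \<Rightarrow> real" where
  "poa_bound M P C = 1 + Max ((\<lambda>n.
     Min {smax M n, demand M - (\<Sum>m\<in>gens M - {n}. smin M m), export_bound M P C n}
       / ((real (card (gens M)) - 2) * demand M)) ` gens M)"

end

theory Submission
  imports Defs
begin

text \<open>Take an edge \<open>{a, b}\<close> and a third bus \<open>c\<close>, let these three buses be the generators, put the
  load \<open>1 - h\<close> on \<open>a\<close> and \<open>h\<close> on \<open>b\<close>, and let the lines at \<open>a\<close> have total capacity at most \<open>h\<close>; then
  \<open>a\<close> can export at most the total demand 1, and \<open>U\<close> lies between \<open>2 - h\<close> and 2. The marginal cost of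
  \<open>a\<close> jumps from about 0 to about 1 at \<open>1 - h\<close>, that of \<open>b\<close> from about 0 to slightly less than 2 at
  \<open>h - \<kappa>\<close>, and that of \<open>c\<close> is 4. The optimum therefore supplies about \<open>1 - h + \<kappa>\<close> from \<open>a\<close> at cost about
  \<open>\<kappa>\<close>. In an equilibrium the marginal costs are inflated by \<open>1 + s\<close>, that is, by almost 2 for \<open>a\<close>
  and almost 1 for \<open>b\<close>, so \<open>a\<close> withholds, supplies about \<open>1 - h\<close>, and the cost is about \<open>2 \<kappa>\<close>.

  Other equilibria could be held in place by congestion. To exclude them, the line \<open>{a, b}\<close> gets a
  huge admittance, so that it is the only line whose limit can be reached, and \<open>c\<close> gets a tiny
  capacity. If that limit were reached, the deviations of \<open>a\<close> and \<open>b\<close> that relieve the line would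
  remain available, and their first order conditions contradict each other.\<close>

section \<open>Smoothed hinge functions\<close>

text \<open>A branch of a hyperbola with asymptotes \<open>0\<close> and \<open>s - u\<close>. It
  smooths the maximum of the two and exceeds it by at most \<open>\<tau> / 2\<close>, attained at
  the kink \<open>u\<close>.\<close>

definition hinge :: "real \<Rightarrow> real \<Rightarrow> real \<Rightarrow> real" where
  "hinge u \<tau> s = ((s - u) + sqrt ((s - u)\<^sup>2 + \<tau>\<^sup>2)) / 2"

definition hinge' :: "real \<Rightarrow> real \<Rightarrow> real \<Rightarrow> real" where
  "hinge' u \<tau> s = (1 + (s - u) / sqrt ((s - u)\<^sup>2 + \<tau>\<^sup>2)) / 2"

context
  fixes u \<tau> :: real
  assumes \<tau>: "\<tau> > 0"
begin

lemma hinge_root_pos: "sqrt ((s - u)\<^sup>2 + \<tau>\<^sup>2) > 0"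
  using \<tau> by (simp add: add_nonneg_pos)

lemma hinge_root_gt: "\<bar>s - u\<bar> < sqrt ((s - u)\<^sup>2 + \<tau>\<^sup>2)"
  using \<tau> by (intro real_less_rsqrt) simp

lemma hinge_deriv: "(hinge u \<tau> has_real_derivative hinge' u \<tau> s) (at s)"
proof -
  have "(s - u)\<^sup>2 + \<tau>\<^sup>2 > 0" using \<tau> by (simp add: add_nonneg_pos)
  then show ?thesis
    unfolding hinge_def[abs_def] hinge'_def
    by (auto intro!: derivative_eq_intros simp: divide_simps)
qed

lemma hinge'_pos: "hinge' u \<tau> s > 0"
  and hinge'_less_1: "hinge' u \<tau> s < 1"
proof -
  have "\<bar>(s - u) / sqrt ((s - u)\<^sup>2 + \<tau>\<^sup>2)\<bar> < 1"
    using hinge_root_gt[of s] hinge_root_pos[of s] by (simp add: abs_divide)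
  then show "hinge' u \<tau> s > 0" "hinge' u \<tau> s < 1"
    unfolding hinge'_def abs_less_iff by simp_all
qed

text \<open>Convexity reduces to the Cauchy-Schwarz inequality for the vectors
  \<open>(s - u, \<tau>)\<close> and \<open>(t - u, \<tau>)\<close>, whose norms are the two
  roots.\<close>

lemma hinge_tangent: "hinge u \<tau> s + hinge' u \<tau> s * (t - s) \<le> hinge u \<tau> t"
proof -
  define R where "R = sqrt ((s - u)\<^sup>2 + \<tau>\<^sup>2)"
  define Q where "Q = sqrt ((t - u)\<^sup>2 + \<tau>\<^sup>2)"
  have R: "R > 0" "R\<^sup>2 = (s - u)\<^sup>2 + \<tau>\<^sup>2" and Q: "Q > 0" "Q\<^sup>2 = (t - u)\<^sup>2 + \<tau>\<^sup>2"
    using hinge_root_pos[of s] hinge_root_pos[of t] by (auto simp: R_def Q_def)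
  have "(s - u) * (t - u) + \<tau>\<^sup>2 \<le> R * Q"
  proof (rule power2_le_imp_le)
    \<comment> \<open>Lagrange's identity in the plane: the defect is the squared determinant of the
      two vectors.\<close>
    have "(R * Q)\<^sup>2 - ((s - u) * (t - u) + \<tau>\<^sup>2)\<^sup>2 = (\<tau> * (t - s))\<^sup>2"
      unfolding power_mult_distrib R(2) Q(2) by (simp add: power2_eq_square algebra_simps)
    then show "((s - u) * (t - u) + \<tau>\<^sup>2)\<^sup>2 \<le> (R * Q)\<^sup>2"
      by (smt (verit) zero_le_power2)
  qed (use R Q in simp)
  then have "R\<^sup>2 + (s - u) * (t - s) \<le> R * Q"
    unfolding R(2) by (simp add: power2_eq_square algebra_simps)
  then have "R + (s - u) / R * (t - s) \<le> Q"
    using R(1) by (simp add: field_simps power2_eq_square)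
  moreover define q where "q = (s - u) / R"
  ultimately have "R + q * (t - s) \<le> Q" by simp
  then show ?thesis
    unfolding hinge_def hinge'_def R_def[symmetric] Q_def[symmetric] q_def[symmetric]
    by (simp add: field_simps)
qed

lemma hinge'_mono: "s \<le> t \<Longrightarrow> hinge' u \<tau> s \<le> hinge' u \<tau> t"
proof (cases "s = t")
  case False
  assume "s \<le> t"
  have "(hinge' u \<tau> s - hinge' u \<tau> t) * (t - s) \<le> 0"
    using hinge_tangent[of s t] hinge_tangent[of t s] by (simp add: algebra_simps)
  with False \<open>s \<le> t\<close> show ?thesis by (simp add: mult_le_0_iff)
qed simp

lemma hinge_nonneg: "hinge u \<tau> s \<ge> 0"
  and hinge_ge: "hinge u \<tau> s \<ge> s - u"
  using hinge_root_gt[of s] by (auto simp: hinge_def)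

lemma hinge_le: "hinge u \<tau> s \<le> max 0 (s - u) + \<tau> / 2"
  using sqrt_sum_squares_le_sum_abs[of "s - u" \<tau>] \<tau>
  by (simp add: hinge_def max_def abs_if split: if_splits)

text \<open>The tangent at \<open>u - L\<close> starts at a nonnegative height and stays below the
  hinge at \<open>u\<close>, whose height is at most \<open>\<tau> / 2\<close>; this caps its
  slope.\<close>

lemma hinge'_left:
  assumes "L > 0" "s \<le> u - L"
  shows "hinge' u \<tau> s \<le> \<tau> / (2 * L)"
proof -
  have "hinge' u \<tau> (u - L) * L \<le> \<tau> / 2"
    using hinge_tangent[of "u - L" u] hinge_nonneg[of "u - L"] hinge_le[of u] by simp
  then show ?thesis
    using hinge'_mono[OF assms(2)] assms(1) by (simp add: field_simps)
       (smt (verit) mult_left_mono)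
qed

text \<open>The tangent at \<open>u + L\<close> starts at height at least \<open>L\<close> and must
  come down to at most \<open>\<tau> / 2\<close> at \<open>u\<close>, so it is steep.\<close>

lemma hinge'_right:
  assumes "L > 0" "s \<ge> u + L"
  shows "hinge' u \<tau> s \<ge> 1 - \<tau> / (2 * L)"
proof -
  have "hinge' u \<tau> (u + L) * L \<ge> L - \<tau> / 2"
    using hinge_tangent[of "u + L" u] hinge_ge[of "u + L"] hinge_le[of u] by simp
  then have "hinge' u \<tau> (u + L) \<ge> 1 - \<tau> / (2 * L)"
    using assms(1) by (simp add: field_simps)
  then show ?thesis
    using hinge'_mono[OF assms(2)] by simp
qed

lemma hinge'_continuous: "continuous_on S (hinge' u \<tau>)"
proof -
  have "(s - u)\<^sup>2 + \<tau>\<^sup>2 \<noteq> 0" for s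
    using hinge_root_pos[of s] by (auto simp del: sum_power2_eq_zero_iff)
  then show ?thesis
    unfolding hinge'_def[abs_def]
    by (intro continuous_intros) (simp_all del: sum_power2_eq_zero_iff)
qed

lemma hinge_strict_mono: "s < t \<Longrightarrow> hinge u \<tau> s < hinge u \<tau> t"
  using hinge_tangent[of s t] hinge'_pos[of s] by (smt (verit) mult_pos_pos)

lemma hinge_lipschitz: "s \<le> t \<Longrightarrow> hinge u \<tau> t \<le> hinge u \<tau> s + (t - s)"
  using hinge_tangent[of t s] hinge'_less_1[of t]
    mult_right_mono[of "hinge' u \<tau> t" 1 "t - s"] by (simp add: algebra_simps)

lemma valid_cost_hinge:
  assumes "\<beta> > 0"
  shows "valid_cost (\<lambda>s. \<beta> * hinge u \<tau> s)"
proof -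
  have d: "((\<lambda>s. \<beta> * hinge u \<tau> s) has_real_derivative \<beta> * hinge' u \<tau> s) (at s)" for s
    by (intro DERIV_cmult hinge_deriv)
  have "convex_on {0..} (\<lambda>s. \<beta> * hinge u \<tau> s)"
    by (rule convex_on_realI[where f' = "\<lambda>s. \<beta> * hinge' u \<tau> s"])
      (use assms in \<open>auto intro!: d mult_left_mono hinge'_mono\<close>)
  moreover have "(\<lambda>s. \<beta> * hinge u \<tau> s) differentiable_on {0..}"
    unfolding differentiable_on_def
    using d has_derivative_at_withinI
    unfolding has_field_derivative_def differentiable_def by blast
  ultimately show ?thesis
    using assms hinge_nonneg hinge_strict_mono
    by (auto simp: valid_cost_def strict_mono_on_def)
qed

end

section \<open>Potential flows\<close>

lemma neighbors_sym: "i \<in> neighbors E m \<longleftrightarrow> m \<in> neighbors E i"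
  by (simp add: neighbors_def insert_commute)

lemma neighbors_subset: "simple_graph N E \<Longrightarrow> neighbors E m \<subseteq> N"
  by (auto simp: simple_graph_def neighbors_def doubleton_eq_iff)

text \<open>The net outflow of a superlevel set of the potential is the sum of the flows over its
  boundary lines. All of these point outwards, so each one is bounded by the net injection of the
  set.\<close>

lemma potential_cut:
  fixes \<theta> :: "'v \<Rightarrow> real"
  assumes gr: "simple_graph N E" and B: "\<And>e. e \<in> E \<Longrightarrow> B e > 0"
    and e: "{i, j} \<in> E" "\<theta> j \<le> t" "t < \<theta> i"
  shows "B {i, j} * (\<theta> i - \<theta> j)
    \<le> (\<Sum>m | m \<in> N \<and> t < \<theta> m. \<Sum>v\<in>neighbors E m. B {m, v} * (\<theta> m - \<theta> v))"
proof -
  define S where "S = {m \<in> N. t < \<theta> m}"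
  define g where "g m v = B {m, v} * (\<theta> m - \<theta> v)" for m v
  have fin: "finite N" using gr by (simp add: simple_graph_def)
  have finS: "finite S" using fin by (simp add: S_def)
  have finn: "finite (neighbors E m)" for m
    using neighbors_subset[OF gr] fin finite_subset by blast
  have anti: "g m v = - g v m" for m v
    by (simp add: g_def insert_commute algebra_simps)
  have split: "(\<Sum>v\<in>neighbors E m. g m v)
      = (\<Sum>v\<in>S. if v \<in> neighbors E m then g m v else 0) + (\<Sum>v\<in>neighbors E m - S. g m v)" for m
  proof -
    have "(\<Sum>v\<in>neighbors E m. g m v)
        = (\<Sum>v\<in>neighbors E m \<inter> S. g m v) + (\<Sum>v\<in>neighbors E m - S. g m v)"
      using sum.Int_Diff[OF finn] by blast
    also have "neighbors E m \<inter> S = S \<inter> {v. v \<in> neighbors E m}" by auto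
    finally show ?thesis by (simp add: sum.inter_restrict[OF finS])
  qed
  \<comment> \<open>\<open>I\<close> collects the lines inside \<open>S\<close>. Each of them is
    counted once in either direction, so \<open>I = - I\<close>.\<close>
  define I where "I = (\<Sum>m\<in>S. \<Sum>v\<in>S. if v \<in> neighbors E m then g m v else 0)"
  have "I = (\<Sum>m\<in>S. \<Sum>v\<in>S. if m \<in> neighbors E v then g v m else 0)"
    unfolding I_def by (rule sum.swap)
  also have "\<dots> = - I"
    unfolding I_def sum_negf[symmetric]
    by (intro sum.cong refl) (metis anti minus_zero neighbors_sym)
  finally have "I = 0" by simp
  then have total: "(\<Sum>m\<in>S. \<Sum>v\<in>neighbors E m. g m v) = (\<Sum>m\<in>S. \<Sum>v\<in>neighbors E m - S. g m v)"
    by (simp add: split sum.distrib I_def)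
  have pos: "0 \<le> g m v" if "m \<in> S" "v \<in> neighbors E m - S" for m v
  proof -
    have "v \<in> N" using that(2) neighbors_subset[OF gr] by auto
    then have "\<theta> v < \<theta> m" using that by (auto simp: S_def)
    moreover have "B {m, v} > 0" using that B by (auto simp: neighbors_def)
    ultimately show ?thesis by (simp add: g_def)
  qed
  have iN: "i \<in> S" "j \<in> neighbors E i - S"
    using neighbors_subset[OF gr, of j] e by (auto simp: S_def neighbors_def insert_commute)
  have "g i j \<le> (\<Sum>v\<in>neighbors E i - S. g i v)"
    by (rule member_le_sum[OF iN(2)]) (use pos iN finn in auto)
  also have "\<dots> \<le> (\<Sum>m\<in>S. \<Sum>v\<in>neighbors E m - S. g m v)"
    by (rule member_le_sum[OF iN(1)]) (use pos finS in \<open>auto intro!: sum_nonneg\<close>)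
  finally show ?thesis unfolding total[symmetric] by (simp add: S_def g_def)
qed

section \<open>The market\<close>

locale tight_market =
  fixes N :: "'v set" and E :: "'v set set" and a b c :: 'v and h :: real
  assumes net: "network N E" and ab: "{a, b} \<in> E" and c: "c \<in> N" "c \<noteq> a" "c \<noteq> b"
    and h: "0 < h" "h \<le> 1 / 100"
begin

text \<open>Limit of every line at \<open>a\<close>. At most \<open>card N\<close> lines end there,
  so together they carry at most \<open>h / 2\<close>.\<close>

definition \<phi> :: real where "\<phi> = h / (2 * real (card N))"
text \<open>Distance of the kink of \<open>cost_b\<close> below \<open>h\<close>, which sets the
  scale of all costs. Shifting supply \<open>\<kappa>\<close> from \<open>b\<close> to
  \<open>a\<close> keeps the line between them below its limit \<open>\<phi>\<close>.\<close>

definition \<kappa> :: real where "\<kappa> = \<phi> / 2"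
text \<open>Small enough for the slopes of the hinges to be within \<open>h / 2\<close> of their
  limits already at distance \<open>h * \<kappa>\<close> from the kink.\<close>

definition \<tau> :: real where "\<tau> = h * h * \<kappa>"
text \<open>First-order expansion of \<open>(2 - h) * (1 - h / 2) / (1 + h)\<close>, and smaller
  than this quotient; \<open>marginal_gt\<close> rests on that.\<close>

definition \<beta> :: real where "\<beta> = 2 - 4 * h"

definition cost_a :: "real \<Rightarrow> real" where "cost_a = hinge (1 - h) \<tau>"
definition cost_b :: "real \<Rightarrow> real" where "cost_b s = \<beta> * hinge (h - \<kappa>) \<tau> s"

text \<open>Lines away from \<open>a\<close> have a limit that is large compared with
  \<open>\<phi>\<close>, so that they never bind, and yet small enough to keep the export bounds of
  \<open>b\<close> and \<open>c\<close> at most \<open>1 / 2\<close>. The demand is 1 and there are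
  three generators, so the denominator in the upper bound is 1.\<close>

definition M :: "'v market" where
  "M = \<lparr>buses = N, lines = E, gens = {a, b, c},
    load = (\<lambda>v. if v = a then 1 - h else if v = b then h else 0),
    cost = (\<lambda>v. if v = a then cost_a else if v = b then cost_b else (*) 4),
    smin = (\<lambda>_. 0), smax = (\<lambda>v. if v = c then \<phi> / 4 else 2),
    flim = (\<lambda>e. if a \<in> e then \<phi> else 1 / (4 * real (card N))),
    adm = (\<lambda>e. if e = {a, b} then 8 * real (card N) / h else 1)\<rparr>"

lemma M_simps:
  "buses M = N" "lines M = E" "gens M = {a, b, c}"
  "load M v = (if v = a then 1 - h else if v = b then h else 0)"
  "cost M v = (if v = a then cost_a else if v = b then cost_b else (*) 4)"
  "smin M v = 0" "smax M v = (if v = c then \<phi> / 4 else 2)"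
  "flim M e = (if a \<in> e then \<phi> else 1 / (4 * real (card N)))"
  "adm M e = (if e = {a, b} then 8 * real (card N) / h else 1)"
  by (simp_all add: M_def)

lemma graph: "simple_graph N E"
  using net by (simp add: network_def)

lemma nodes: "a \<in> N" "b \<in> N" "a \<noteq> b" "finite N" "card N \<ge> 3"
  using net ab by (auto simp: network_def simple_graph_def doubleton_eq_iff)

lemma parameters: "\<phi> > 0" "\<phi> \<le> h / 6" "\<kappa> > 0" "\<tau> > 0" "\<beta> > 1"
  "\<phi> * real (card N) = h / 2"
  using h nodes by (auto simp: \<phi>_def \<kappa>_def \<tau>_def \<beta>_def field_simps)

lemma sum_gens: "(\<Sum>n\<in>{a, b, c}. f n) = f a + f b + (f c :: real)"
  using c nodes by (simp add: add.assoc)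

lemma sum_load: "(\<Sum>m\<in>N. A m * load M m) = A a * (1 - h) + A b * h"
proof -
  have "(\<Sum>m\<in>N. A m * load M m) = (\<Sum>m\<in>{a, b}. A m * load M m)"
    using nodes by (intro sum.mono_neutral_right) (auto simp: M_simps)
  then show ?thesis using nodes by (simp add: M_simps)
qed

lemma demand_M: "demand M = 1"
  using sum_load[of "\<lambda>_. 1"] by (simp add: demand_def M_simps(1))

lemma card_gens: "card (gens M) = 3"
  using c nodes by (simp add: M_simps)

lemma valid_market_M: "valid_market M"
proof -
  have diffs: "{a, b, c} - {a} = {b, c}" "{a, b, c} - {b} = {a, c}" "{a, b, c} - {c} = {a, b}"
    using c nodes by auto
  have "valid_cost ((*) 4)"
    unfolding valid_cost_def
    by (auto simp: strict_mono_on_def convex_on_def algebra_simps intro!: derivative_intros)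
  moreover have "valid_cost cost_a" "valid_cost cost_b"
    using valid_cost_hinge[OF parameters(4), of 1] valid_cost_hinge[OF parameters(4), of \<beta>]
      parameters by (auto simp: cost_a_def cost_b_def[abs_def])
  moreover have "gens M \<subseteq> buses M" "\<forall>j\<in>buses M. load M j \<ge> 0"
    using nodes c h by (auto simp: M_simps)
  moreover have "\<forall>e\<in>lines M. adm M e > 0 \<and> flim M e \<ge> 0"
    using nodes h parameters by (auto simp: M_simps)
  moreover have "\<forall>n\<in>gens M. (\<Sum>m\<in>gens M - {n}. smax M m) > demand M"
    using c nodes parameters by (auto simp: M_simps(3) diffs demand_M) (auto simp: M_simps)
  ultimately show ?thesis
    using net card_gens demand_M parameters
    unfolding valid_market_def by (auto simp: M_simps)
qed

section \<open>Effective flow limits and the upper bound\<close>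

lemma flim_nonneg: "flim M e \<ge> 0" and adm_pos: "adm M e > 0"
  using parameters nodes h by (auto simp: M_simps)

lemma eff_flim_bounds: "0 \<le> eff_flim M P C n m" "eff_flim M P C n m \<le> flim M {n, m}"
  using flim_nonneg adm_pos less_imp_le[OF adm_pos]
  by (auto simp: eff_flim_def intro!: mult_nonneg_nonneg sum_nonneg divide_nonneg_nonneg)

lemma finite_neighbors: "finite (neighbors E m)"
  and card_neighbors: "card (neighbors E m) \<le> card N"
  using neighbors_subset[OF graph] nodes by (auto intro: finite_subset card_mono)

lemma export_bound_bounds:
  assumes "\<And>m. m \<in> neighbors E n \<Longrightarrow> flim M {n, m} \<le> f" "f \<ge> 0"
  shows "load M n \<le> export_bound M P C n"
    and "export_bound M P C n \<le> load M n + real (card N) * f"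
proof -
  show "load M n \<le> export_bound M P C n"
    using eff_flim_bounds by (auto simp: export_bound_def intro!: sum_nonneg)
  have "(\<Sum>m\<in>neighbors E n. eff_flim M P C n m) \<le> real (card (neighbors E n)) * f"
    using eff_flim_bounds(2) assms(1) by (intro sum_bounded_above) (meson order_trans)
  also have "\<dots> \<le> real (card N) * f"
    using card_neighbors assms(2) by (intro mult_right_mono) auto
  finally show "export_bound M P C n \<le> load M n + real (card N) * f"
    by (simp add: export_bound_def M_simps)
qed

lemma export_bounds:
  "1 - h \<le> export_bound M P C a" "export_bound M P C a \<le> 1"
  "export_bound M P C b \<le> 1 / 2" "export_bound M P C c \<le> 1 / 2"
proof -
  have f: "flim M e \<le> 1 / (4 * real (card N))" for e
    using h nodes by (auto simp: M_simps \<phi>_def field_simps)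
  show "1 - h \<le> export_bound M P C a" "export_bound M P C a \<le> 1"
    using export_bound_bounds[of a \<phi> P C] parameters h by (auto simp: M_simps mult.commute)
  show "export_bound M P C b \<le> 1 / 2" "export_bound M P C c \<le> 1 / 2"
    using export_bound_bounds(2)[OF f, where n = b and P = P and C = C]
      export_bound_bounds(2)[OF f, where n = c and P = P and C = C]
      nodes h c by (auto simp: M_simps split: if_splits)
qed

text \<open>At \<open>a\<close> the export bound is the smallest of the three terms, and it is at
  least \<open>1 - h\<close>. The export bounds of \<open>b\<close> and \<open>c\<close> are at most
  \<open>1 / 2\<close>, so the maximum is attained at \<open>a\<close> with or without the inner
  minimum.\<close>

lemma poa_bound_M:
  "poa_bound M P C = 1 + export_bound M P C a"
  "1 + Max ((\<lambda>n. export_bound M P C n / ((real (card (gens M)) - 2) * demand M)) ` gens M)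
    = 1 + export_bound M P C a"
proof -
  have smin: "demand M - (\<Sum>m\<in>A. smin M m) = 1" for A
    by (simp add: demand_M M_simps)
  have m: "Min {smax M a, 1, export_bound M P C a} = export_bound M P C a"
    using export_bounds[of P C] c by (simp add: M_simps min_def)
  have "Max ((\<lambda>n. Min {smax M n, 1, export_bound M P C n}) ` {a, b, c}) = export_bound M P C a"
    by (rule Max_eqI) (use m export_bounds[of P C] h in \<open>auto simp: min_le_iff_disj\<close>)
  then show "poa_bound M P C = 1 + export_bound M P C a"
    unfolding poa_bound_def card_gens smin unfolding demand_M M_simps(3) by simp
  have "Max ((\<lambda>n. export_bound M P C n) ` {a, b, c}) = export_bound M P C a"
    by (rule Max_eqI) (use export_bounds[of P C] h in auto)
  then show "1 + Max ((\<lambda>n. export_bound M P C n / ((real (card (gens M)) - 2) * demand M)) ` gens M)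
      = 1 + export_bound M P C a"
    unfolding card_gens unfolding demand_M M_simps(3) by simp
qed

end

section \<open>Flow limits of the market\<close>

locale tight_grid = tight_market N E a b c h
  for N :: "'v set" and E :: "'v set set" and a b c :: 'v and h :: real +
  fixes ori :: "'v set \<Rightarrow> 'v \<times> 'v" and Ag Al :: "'v set \<Rightarrow> 'v \<Rightarrow> real"
  assumes ori: "orientation E ori" and sf: "shift_factors M ori Ag Al"
begin

lemma flow_from_to_abs: "\<bar>flow_from_to ori p i j\<bar> = \<bar>p {i, j}\<bar>"
  by (simp add: flow_from_to_def)

text \<open>Restates the defining property of the shift factors by a potential, together with the
  cut bound on single lines, in terms of the net injections \<open>q\<close>.\<close>

lemma balanced_potential:
  assumes "(\<Sum>n\<in>{a, b, c}. s n) = (\<Sum>m\<in>N. d m)"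
  defines "q \<equiv> \<lambda>m. if m \<in> {a, b, c} then s m - d m else - d m"
  obtains \<theta> where
    "\<And>i j. {i, j} \<in> E \<Longrightarrow>
      flow_from_to ori (grid_flow M Ag Al s d) i j = adm M {i, j} * (\<theta> i - \<theta> j)"
    "\<And>i j t. {i, j} \<in> E \<Longrightarrow> \<theta> j \<le> t \<Longrightarrow> t < \<theta> i \<Longrightarrow>
      adm M {i, j} * (\<theta> i - \<theta> j) \<le> (\<Sum>m | m \<in> N \<and> t < \<theta> m. q m)"
    "\<And>m. m \<in> N \<Longrightarrow>
      (\<Sum>v\<in>neighbors E m. flow_from_to ori (grid_flow M Ag Al s d) m v) = q m"
proof -
  define p where "p = grid_flow M Ag Al s d"
  have "line_flows M ori s d p"
    using sf assms(1) by (simp add: shift_factors_def M_simps p_def)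
  then obtain \<theta> where
    \<theta>: "\<And>i j. {i, j} \<in> E \<Longrightarrow> flow_from_to ori p i j = adm M {i, j} * (\<theta> i - \<theta> j)"
    and bal: "\<And>m. m \<in> N \<Longrightarrow> (\<Sum>v\<in>neighbors E m. flow_from_to ori p m v) = q m"
    unfolding line_flows_def M_simps(1-3) q_def by blast
  have bal': "(\<Sum>v\<in>neighbors E m. adm M {m, v} * (\<theta> m - \<theta> v)) = q m" if "m \<in> N" for m
    unfolding bal[OF that, symmetric] by (intro sum.cong refl) (simp add: \<theta> neighbors_def)
  show ?thesis
  proof (rule that[of \<theta>])
    fix i j t assume *: "{i, j} \<in> E" "\<theta> j \<le> t" "t < \<theta> i"
    have "(\<Sum>m | m \<in> N \<and> t < \<theta> m. q m)
        = (\<Sum>m | m \<in> N \<and> t < \<theta> m. \<Sum>v\<in>neighbors E m. adm M {m, v} * (\<theta> m - \<theta> v))"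
      by (intro sum.cong refl) (simp add: bal')
    then show "adm M {i, j} * (\<theta> i - \<theta> j) \<le> (\<Sum>m | m \<in> N \<and> t < \<theta> m. q m)"
      by (rule ord_le_eq_trans[OF potential_cut[where B = "adm M", OF graph adm_pos *] sym])
  qed (fact \<theta>[unfolded p_def] bal[unfolded p_def])+
qed

text \<open>All load sits at generators, so every bus can serve its own. Then every cut has net
  injection zero and the potential is equal at both ends of each line. This profile is the origin
  for the linear expansion of the flows.\<close>

lemma grid_flow_load:
  assumes "e \<in> E"
  shows "grid_flow M Ag Al (load M) (load M) e = 0"
proof -
  have "(\<Sum>n\<in>{a, b, c}. load M n) = (\<Sum>m\<in>N. load M m)"
    using sum_load[of "\<lambda>_. 1"] c nodes by (simp add: M_simps)
  then obtain \<theta> where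
    \<theta>: "\<And>i j. {i, j} \<in> E \<Longrightarrow>
      flow_from_to ori (grid_flow M Ag Al (load M) (load M)) i j = adm M {i, j} * (\<theta> i - \<theta> j)"
    and cut: "\<And>i j t. {i, j} \<in> E \<Longrightarrow> \<theta> j \<le> t \<Longrightarrow> t < \<theta> i \<Longrightarrow> adm M {i, j} * (\<theta> i - \<theta> j)
      \<le> (\<Sum>m | m \<in> N \<and> t < \<theta> m. if m \<in> {a, b, c} then load M m - load M m else - load M m)"
    by (rule balanced_potential) blast
  have "\<theta> i \<le> \<theta> j" if "{i, j} \<in> E" for i j
  proof (rule ccontr)
    assume "\<not> \<theta> i \<le> \<theta> j"
    then have "adm M {i, j} * (\<theta> i - \<theta> j)
      \<le> (\<Sum>m | m \<in> N \<and> \<theta> j < \<theta> m. if m \<in> {a, b, c} then load M m - load M m else - load M m)"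
      using that by (intro cut) auto
    also have "\<dots> = 0" by (intro sum.neutral) (auto simp: M_simps)
    finally show False
      using \<open>\<not> \<theta> i \<le> \<theta> j\<close> adm_pos[of "{i, j}"] by (simp add: mult_le_0_iff)
  qed
  note le = this
  obtain i j where "e = {i, j}"
    using graph assms by (auto simp: simple_graph_def)
  then have "\<theta> i = \<theta> j"
    using le[of i j] le[of j i] assms by (simp add: insert_commute)
  then show ?thesis
    using \<theta>[of i j] flow_from_to_abs[of "grid_flow M Ag Al (load M) (load M)" i j] assms \<open>e = {i, j}\<close>
    by simp
qed

text \<open>Flows caused by sending one unit from \<open>n\<close> to \<open>a\<close>.\<close>

definition transfer :: "'v \<Rightarrow> 'v set \<Rightarrow> real" where
  "transfer n e = Ag e n - Ag e a"

lemma transfer_potential: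
  assumes n: "n = b \<or> n = c"
  obtains \<theta> where
    "\<And>i j. {i, j} \<in> E \<Longrightarrow> flow_from_to ori (transfer n) i j = adm M {i, j} * (\<theta> i - \<theta> j)"
    "\<And>i j t. {i, j} \<in> E \<Longrightarrow> \<theta> j \<le> t \<Longrightarrow> t < \<theta> i \<Longrightarrow>
      adm M {i, j} * (\<theta> i - \<theta> j) \<le> (if t < \<theta> n then 1 else 0) - (if t < \<theta> a then 1 else 0)"
    "(\<Sum>v\<in>neighbors E a. flow_from_to ori (transfer n) a v) = - 1"
proof -
  \<comment> \<open>Supply 1 at \<open>n\<close> and -1 at \<open>a\<close>, with zero demand, is
    balanced, and the shift factors describe its flows although it is not a feasible supply.\<close>
  define s :: "'v \<Rightarrow> real" where "s = (\<lambda>v. (if v = n then 1 else 0) - (if v = a then 1 else 0))"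
  have nN: "n \<in> N" "n \<noteq> a" "n \<in> {a, b, c}" using n nodes c by auto
  have flow: "grid_flow M Ag Al s (\<lambda>_. 0) = transfer n"
    using n nodes c by (auto simp: grid_flow_def transfer_def M_simps(3) sum_gens s_def)
  have q: "(if m \<in> {a, b, c} then s m - 0 else - 0) = s m" for m
    using nN by (auto simp: s_def)
  have "(\<Sum>n\<in>{a, b, c}. s n) = (\<Sum>m\<in>N. 0)"
    using n nodes c by (auto simp: sum_gens s_def)
  then obtain \<theta> where
    \<theta>: "\<And>i j. {i, j} \<in> E \<Longrightarrow> flow_from_to ori (transfer n) i j = adm M {i, j} * (\<theta> i - \<theta> j)"
    and cut: "\<And>i j t. {i, j} \<in> E \<Longrightarrow> \<theta> j \<le> t \<Longrightarrow> t < \<theta> i \<Longrightarrow>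
      adm M {i, j} * (\<theta> i - \<theta> j) \<le> (\<Sum>m | m \<in> N \<and> t < \<theta> m. s m)"
    and bal: "\<And>m. m \<in> N \<Longrightarrow> (\<Sum>v\<in>neighbors E m. flow_from_to ori (transfer n) m v) = s m"
    by (rule balanced_potential[where s = s and d = "\<lambda>_. 0", unfolded q flow]) blast
  have "(\<Sum>m | m \<in> N \<and> t < \<theta> m. s m)
      = (if t < \<theta> n then 1 else 0) - (if t < \<theta> a then 1 else 0)" for t
    using nodes nN by (simp add: s_def sum_subtractf)
  then show ?thesis
    using cut bal[of a] nodes nN by (intro that[of \<theta>] \<theta>) (auto simp: s_def)
qed

text \<open>A cut has net injection at most 1 when one unit is sent, which bounds the flow in both
  directions of the line.\<close>

lemma transfer_abs_le:
  assumes n: "n = b \<or> n = c" and e: "e \<in> E"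
  shows "\<bar>transfer n e\<bar> \<le> 1"
proof -
  obtain \<theta> where
    \<theta>: "\<And>i j. {i, j} \<in> E \<Longrightarrow> flow_from_to ori (transfer n) i j = adm M {i, j} * (\<theta> i - \<theta> j)"
    and cut: "\<And>i j t. {i, j} \<in> E \<Longrightarrow> \<theta> j \<le> t \<Longrightarrow> t < \<theta> i \<Longrightarrow>
      adm M {i, j} * (\<theta> i - \<theta> j) \<le> (if t < \<theta> n then 1 else 0) - (if t < \<theta> a then 1 else 0)"
    using transfer_potential[OF n] by metis
  have le: "adm M {i, j} * (\<theta> i - \<theta> j) \<le> 1" if "{i, j} \<in> E" for i j
  proof (cases "\<theta> j < \<theta> i")
    case True
    then show ?thesis using cut[OF that order_refl True] by (auto split: if_splits)
  next
    case False
    then have "adm M {i, j} * (\<theta> i - \<theta> j) \<le> 0"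
      using adm_pos[of "{i, j}"] by (intro mult_nonneg_nonpos) auto
    then show ?thesis by simp
  qed
  obtain i j where ij: "e = {i, j}"
    using graph e by (auto simp: simple_graph_def)
  have "\<bar>transfer n e\<bar> = \<bar>adm M {i, j} * (\<theta> i - \<theta> j)\<bar>"
    using \<theta>[of i j] flow_from_to_abs[of "transfer n" i j] e ij by simp
  also have "\<dots> \<le> 1"
    using le[of i j] le[of j i] e ij
    by (simp add: abs_le_iff insert_commute algebra_simps)
  finally show ?thesis .
qed

definition flow_b :: real where "flow_b = flow_from_to ori (transfer b) b a"
definition flow_c :: real where "flow_c = flow_from_to ori (transfer c) b a"

text \<open>Flow cannot leave the sink \<open>a\<close>: if \<open>\<theta> a > \<theta> b\<close>,
  the superlevel set at level \<open>\<theta> b\<close> contains \<open>a\<close> and has net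
  injection at most 0, against a positive flow from \<open>a\<close> to \<open>b\<close>.\<close>

lemma flow_c_bounds: "0 \<le> flow_c" "flow_c \<le> 1"
proof -
  have ba: "{b, a} \<in> E" using ab by (simp add: insert_commute)
  obtain \<theta> where
    \<theta>: "\<And>i j. {i, j} \<in> E \<Longrightarrow> flow_from_to ori (transfer c) i j = adm M {i, j} * (\<theta> i - \<theta> j)"
    and cut: "\<And>i j t. {i, j} \<in> E \<Longrightarrow> \<theta> j \<le> t \<Longrightarrow> t < \<theta> i \<Longrightarrow>
      adm M {i, j} * (\<theta> i - \<theta> j) \<le> (if t < \<theta> c then 1 else 0) - (if t < \<theta> a then 1 else 0)"
    using transfer_potential[of c] by metis
  have "\<theta> a \<le> \<theta> b"
  proof (rule ccontr)
    assume *: "\<not> \<theta> a \<le> \<theta> b"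
    then have "adm M {a, b} * (\<theta> a - \<theta> b) \<le> 0"
      using cut[OF ab order_refl] by (auto split: if_splits)
    then show False using * adm_pos[of "{a, b}"] by (simp add: mult_le_0_iff)
  qed
  then show "0 \<le> flow_c"
    using adm_pos[of "{b, a}"] by (simp add: flow_c_def \<theta>[OF ba])
  show "flow_c \<le> 1"
    using transfer_abs_le[of c "{b, a}"] ba flow_from_to_abs[of "transfer c" b a]
    by (simp add: flow_c_def)
qed

text \<open>The line between \<open>a\<close> and \<open>b\<close> has so large an admittance that it carries almost all of the
  flow between its endpoints.\<close>

lemma
  shows flow_b_le: "flow_b \<le> 1" and flow_b_ge: "1 - h / 8 \<le> flow_b"
    and transfer_b_small:
      "\<And>m. {a, m} \<in> E \<Longrightarrow> m \<noteq> b \<Longrightarrow> \<bar>transfer b {a, m}\<bar> \<le> h / (8 * real (card N))"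
proof -
  have ba: "{b, a} \<in> E" using ab by (simp add: insert_commute)
  show "flow_b \<le> 1"
    using transfer_abs_le[of b "{b, a}"] ba flow_from_to_abs[of "transfer b" b a]
    by (simp add: flow_b_def)
  obtain \<theta> where
    \<theta>: "\<And>i j. {i, j} \<in> E \<Longrightarrow> flow_from_to ori (transfer b) i j = adm M {i, j} * (\<theta> i - \<theta> j)"
    and cut: "\<And>i j t. {i, j} \<in> E \<Longrightarrow> \<theta> j \<le> t \<Longrightarrow> t < \<theta> i \<Longrightarrow>
      adm M {i, j} * (\<theta> i - \<theta> j) \<le> (if t < \<theta> b then 1 else 0) - (if t < \<theta> a then 1 else 0)"
    and bal: "(\<Sum>v\<in>neighbors E a. flow_from_to ori (transfer b) a v) = - 1"
    using transfer_potential[of b] by metis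
  have ge: "\<theta> a \<le> \<theta> m" if "{a, m} \<in> E" for m
  proof (rule ccontr)
    assume *: "\<not> \<theta> a \<le> \<theta> m"
    then have "adm M {a, m} * (\<theta> a - \<theta> m) \<le> 0"
      using cut[OF that order_refl] by (auto split: if_splits)
    then show False using * adm_pos[of "{a, m}"] by (simp add: mult_le_0_iff)
  qed
  \<comment> \<open>Cut at level \<open>\<theta> b\<close>: the superlevel set contains neither
    \<open>a\<close> nor \<open>b\<close> and therefore has no net injection.\<close>
  have le: "\<theta> m \<le> \<theta> b" if "{a, m} \<in> E" for m
  proof (rule ccontr)
    assume *: "\<not> \<theta> m \<le> \<theta> b"
    have "{m, a} \<in> E" using that by (simp add: insert_commute)
    then have "adm M {m, a} * (\<theta> m - \<theta> a) \<le> 0"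
      using cut[of m a "\<theta> b"] ge[OF ab] * by auto
    then show False using * ge[OF ab] adm_pos[of "{m, a}"] by (simp add: mult_le_0_iff)
  qed
  \<comment> \<open>A flow of at most 1 over the huge admittance leaves only a tiny potential
    difference between \<open>b\<close> and \<open>a\<close>. The other lines at \<open>a\<close>
    have admittance 1 and see no larger difference.\<close>
  have "8 * real (card N) / h * (\<theta> b - \<theta> a) \<le> 1"
    using \<open>flow_b \<le> 1\<close> by (simp add: flow_b_def \<theta>[OF ba] M_simps insert_commute)
  then have "(\<theta> b - \<theta> a) * (8 * real (card N)) \<le> h"
    using h by (simp add: field_simps)
  then have gap: "\<theta> b - \<theta> a \<le> h / (8 * real (card N))"
    using nodes by (subst pos_le_divide_eq) auto
  have small: "\<bar>flow_from_to ori (transfer b) a m\<bar> \<le> h / (8 * real (card N))"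
    if "{a, m} \<in> E" "m \<noteq> b" for m
    using ge[OF that(1)] le[OF that(1)] gap that nodes
    by (simp add: \<theta>[OF that(1)] M_simps doubleton_eq_iff)
  then show "\<And>m. {a, m} \<in> E \<Longrightarrow> m \<noteq> b \<Longrightarrow> \<bar>transfer b {a, m}\<bar> \<le> h / (8 * real (card N))"
    by (simp add: flow_from_to_abs)
  have "- 1 = flow_from_to ori (transfer b) a b
      + (\<Sum>v\<in>neighbors E a - {b}. flow_from_to ori (transfer b) a v)"
    using ab by (subst bal[symmetric], intro sum.remove finite_neighbors) (simp add: neighbors_def)
  moreover have "flow_from_to ori (transfer b) a b = - flow_b"
    by (simp add: flow_b_def \<theta>[OF ba] \<theta>[OF ab] insert_commute algebra_simps)
  moreover have "- (h / 8) \<le> (\<Sum>v\<in>neighbors E a - {b}. flow_from_to ori (transfer b) a v)"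
  proof -
    have "- (\<Sum>v\<in>neighbors E a - {b}. flow_from_to ori (transfer b) a v)
        \<le> real (card (neighbors E a - {b})) * (h / (8 * real (card N)))"
      unfolding sum_negf[symmetric]
      by (rule sum_bounded_above) (use small in \<open>force simp: neighbors_def abs_le_iff\<close>)
    also have "\<dots> \<le> real (card N) * (h / (8 * real (card N)))"
      using h card_neighbors[of a] card_mono[OF finite_neighbors, of "neighbors E a - {b}" a]
      by (intro mult_right_mono) auto
    also have "\<dots> = h / 8" using nodes by (cases "N = {}") simp_all
    finally show ?thesis by simp
  qed
  ultimately show "1 - h / 8 \<le> flow_b" by simp
qed

text \<open>Flow from \<open>b\<close> to \<open>a\<close> in a balanced profile: relative to the
  flowless profile, \<open>b\<close> and \<open>c\<close> send their excess to
  \<open>a\<close>.\<close>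

definition ba_flow :: "('v \<Rightarrow> real) \<Rightarrow> real" where
  "ba_flow s = (s b - h) * flow_b + s c * flow_c"

lemma grid_flow_eq:
  assumes "s a + s b + s c = 1" "e \<in> E"
  shows "grid_flow M Ag Al s (load M) e = (s b - h) * transfer b e + s c * transfer c e"
proof -
  have sa: "s a = 1 - s b - s c" using assms by simp
  show ?thesis
    using grid_flow_load[OF assms(2)] nodes c
    by (simp add: grid_flow_def transfer_def M_simps(3) sum_gens)
      (simp add: M_simps sa algebra_simps)
qed

lemma grid_flow_ab:
  assumes "s a + s b + s c = 1"
  shows "\<bar>grid_flow M Ag Al s (load M) {a, b}\<bar> = \<bar>ba_flow s\<bar>"
  by (simp add: grid_flow_eq[OF assms ab] ba_flow_def flow_b_def flow_c_def flow_from_to_def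
      insert_commute[of b] abs_if algebra_simps)

lemma within_imp_ba_flow:
  assumes "s a + s b + s c = 1" "within_flow_limits M Ag Al s"
  shows "\<bar>ba_flow s\<bar> \<le> \<phi>"
  using assms(2) ab grid_flow_ab[OF assms(1)]
  by (auto simp: within_flow_limits_def M_simps abs_le_iff)

text \<open>The contribution of \<open>c\<close> is at most \<open>\<phi> / 2\<close>, and
  \<open>flow_b\<close> is at least \<open>3 / 4\<close>, so a bound on the flow over the line is a
  bound on the excess of \<open>b\<close>.\<close>

lemma supply_b_bound:
  assumes "\<bar>ba_flow s\<bar> \<le> \<phi>" "\<bar>s c\<bar> \<le> \<phi> / 2"
  shows "\<bar>s b - h\<bar> \<le> 2 * \<phi>"
proof -
  have "\<bar>s c * flow_c\<bar> \<le> \<phi> / 2 * 1"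
    unfolding abs_mult using flow_c_bounds assms by (intro mult_mono) auto
  then have "\<bar>(s b - h) * flow_b\<bar> \<le> 3 / 2 * \<phi>"
    using assms(1) by (simp add: ba_flow_def)
  moreover have "\<bar>s b - h\<bar> * (3 / 4) \<le> \<bar>(s b - h) * flow_b\<bar>"
    unfolding abs_mult using flow_b_ge h by (intro mult_left_mono) auto
  ultimately show ?thesis by simp
qed

text \<open>Only the line between \<open>a\<close> and \<open>b\<close> can be congested. The other
  lines at \<open>a\<close> carry at most \<open>2 * \<phi> / 4 + \<phi> / 2\<close>, and lines away
  from \<open>a\<close> at most \<open>5 / 2 * \<phi>\<close>.\<close>

lemma within_flow_limitsI:
  assumes bal: "s a + s b + s c = 1" and f: "\<bar>ba_flow s\<bar> \<le> \<phi>" and z: "\<bar>s c\<bar> \<le> \<phi> / 2"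
  shows "within_flow_limits M Ag Al s"
proof -
  have y: "\<bar>s b - h\<bar> \<le> 2 * \<phi>" by (rule supply_b_bound[OF f z])
  have "\<bar>grid_flow M Ag Al s (load M) e\<bar> \<le> flim M e" if e: "e \<in> E" for e
  proof -
    have tri: "\<bar>grid_flow M Ag Al s (load M) e\<bar> \<le> \<bar>s b - h\<bar> * \<bar>transfer b e\<bar> + \<phi> / 2 * 1"
    proof -
      have "\<bar>s c * transfer c e\<bar> \<le> \<phi> / 2 * 1"
        unfolding abs_mult using transfer_abs_le[of c e] e z by (intro mult_mono) auto
      then show ?thesis
        unfolding grid_flow_eq[OF bal e] abs_mult[symmetric] by linarith
    qed
    consider "e = {a, b}" | m where "e = {a, m}" "m \<noteq> b" | "a \<notin> e"
    proof (cases "a \<in> e")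
      case True
      obtain i j where "e = {i, j}" using graph e by (auto simp: simple_graph_def)
      with True have "\<exists>m. e = {a, m}" by (auto simp: insert_commute)
      then show ?thesis using that(1,2) by blast
    qed (rule that(3))
    then show ?thesis
    proof cases
      case 1
      then show ?thesis using grid_flow_ab[OF bal] f by (simp add: M_simps)
    next
      case 2
      have "h / (8 * real (card N)) \<le> 1 / 4" using h nodes by (simp add: field_simps)
      then have "\<bar>s b - h\<bar> * \<bar>transfer b e\<bar> \<le> 2 * \<phi> * (1 / 4)"
        using transfer_b_small[of m] e 2 y by (intro mult_mono) auto
      then show ?thesis using tri 2 by (simp add: M_simps)
    next
      case 3
      have "\<bar>s b - h\<bar> * \<bar>transfer b e\<bar> \<le> 2 * \<phi> * 1"
        using transfer_abs_le[of b e] e y by (intro mult_mono) auto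
      then have "\<bar>grid_flow M Ag Al s (load M) e\<bar> \<le> 5 / 2 * \<phi>" using tri by simp
      also have "\<dots> \<le> 1 / (4 * real (card N))"
        using h nodes by (simp add: \<phi>_def field_simps)
      finally show ?thesis using 3 by (simp add: M_simps)
    qed
  qed
  then show ?thesis unfolding within_flow_limits_def M_simps(1,2)
    by (simp add: abs_le_iff[of "grid_flow _ _ _ _ _ _"]) (smt (verit))
qed

lemma strictly_feasible_M: "strictly_feasible M Ag Al"
proof -
  \<comment> \<open>Nearly the flowless profile, with \<open>c\<close> at half of its capacity and
    \<open>a\<close> reduced accordingly.\<close>
  define s where "s = (\<lambda>v. if v = a then 1 - h - \<phi> / 8 else if v = b then h else \<phi> / 8)"
  have s: "s a = 1 - h - \<phi> / 8" "s b = h" "s c = \<phi> / 8"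
    using nodes c by (auto simp: s_def)
  have lt: "\<bar>grid_flow M Ag Al s (load M) e\<bar> < flim M e" if "e \<in> E" for e
  proof -
    have "\<bar>grid_flow M Ag Al s (load M) e\<bar> = \<phi> / 8 * \<bar>transfer c e\<bar>"
      using that s parameters by (simp add: grid_flow_eq abs_mult)
    also have "\<dots> \<le> \<phi> / 8 * 1"
      using transfer_abs_le[of c e] that parameters by (intro mult_left_mono) auto
    also have "\<dots> < flim M e"
      using parameters h nodes by (auto simp: M_simps) (simp add: \<phi>_def field_simps)
    finally show ?thesis .
  qed
  have "- flim M e < grid_flow M Ag Al s (load M) e \<and> grid_flow M Ag Al s (load M) e < flim M e"
    if "e \<in> E" for e
    using lt[OF that] by linarith
  moreover have "\<forall>n\<in>gens M. smin M n < s n \<and> s n < smax M n"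
    using parameters h c by (auto simp: s M_simps)
  moreover have "(\<Sum>n\<in>gens M. s n) = demand M"
    by (simp add: M_simps(3) demand_M sum_gens s)
  ultimately show ?thesis
    unfolding strictly_feasible_def M_simps(2) by blast
qed

end

section \<open>Deviations and marginal costs\<close>

text \<open>\<open>F\<close> is the current flow and \<open>D\<close> its rate of change. A limit
  that binds is not approached, and \<open>\<bar>D\<bar> \<le> 2\<close> gives an explicit step from
  the distance to the other one.\<close>

lemma small_step:
  fixes F D \<phi> :: real
  assumes "\<bar>F\<bar> \<le> \<phi>" "\<phi> > 0" "F < \<phi> \<or> D \<le> 0" "- \<phi> < F \<or> 0 \<le> D" "\<bar>D\<bar> \<le> 2"
  obtains t0 where "t0 > 0" "\<And>t. 0 < t \<Longrightarrow> t < t0 \<Longrightarrow> \<bar>F + t * D\<bar> \<le> \<phi>"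
proof (cases "D \<le> 0")
  case True
  show ?thesis
  proof (rule that[of "if D = 0 then 1 else (F + \<phi>) / 2"])
    show "(if D = 0 then 1 else (F + \<phi>) / 2) > 0" using assms True by auto
    fix t assume t: "0 < t" "t < (if D = 0 then 1 else (F + \<phi>) / 2)"
    show "\<bar>F + t * D\<bar> \<le> \<phi>"
    proof (cases "D = 0")
      case False
      have "t * (- D) \<le> t * 2" using t assms by (intro mult_left_mono) auto
      moreover have "t * D \<le> 0" using t True by (intro mult_nonneg_nonpos) auto
      ultimately show ?thesis using t False assms(1) by (auto simp: abs_le_iff)
    qed (use assms in simp)
  qed
next
  case False
  show ?thesis
  proof (rule that[of "(\<phi> - F) / 2"])
    show "(\<phi> - F) / 2 > 0" using assms False by auto
    fix t assume t: "0 < t" "t < (\<phi> - F) / 2"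
    have "t * D \<le> t * 2" using t assms by (intro mult_left_mono) auto
    moreover have "t * D \<ge> 0" using t False by (intro mult_nonneg_nonneg) auto
    moreover have "t * 2 < \<phi> - F" using t by simp
    ultimately show "\<bar>F + t * D\<bar> \<le> \<phi>" using assms(1) by linarith
  qed
qed

context tight_market
begin

definition marginal :: "'v \<Rightarrow> real \<Rightarrow> real" where
  "marginal n s = (if n = a then hinge' (1 - h) \<tau> s
     else if n = b then \<beta> * hinge' (h - \<kappa>) \<tau> s else 4)"

lemma cost_deriv: "(cost M n has_real_derivative marginal n s) (at s)"
  using parameters
  by (auto simp: M_simps marginal_def cost_a_def cost_b_def[abs_def]
      intro!: hinge_deriv DERIV_cmult derivative_eq_intros)

lemma cost_tangent: "cost M n s + marginal n s * (t - s) \<le> cost M n t"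
  using hinge_tangent[OF parameters(4), of "1 - h" s t]
    mult_left_mono[OF hinge_tangent[OF parameters(4), of "h - \<kappa>" s t], of \<beta>] parameters
  by (simp add: M_simps marginal_def cost_a_def cost_b_def algebra_simps)

lemma \<tau>_div: "\<tau> / (2 * (h * \<kappa>)) = h / 2" "\<tau> / (2 * \<kappa>) = h * h / 2"
  using h parameters by (auto simp: \<tau>_def)

text \<open>At an interior best response the price equals \<open>(1 + s)\<close> times the marginal cost.\<close>

lemma marginal_gt:
  assumes "1 - h + h * \<kappa> \<le> s" "0 \<le> s'" "s' \<le> h"
  shows "(1 + s') * marginal b s' < (1 + s) * marginal a s"
proof -
  have "1 - h / 2 \<le> hinge' (1 - h) \<tau> s"
    using hinge'_right[OF parameters(4), of "h * \<kappa>" "1 - h" s] h parameters assms \<tau>_div by simp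
  then have "(2 - h) * (1 - h / 2) \<le> (1 + s) * hinge' (1 - h) \<tau> s"
    using assms h mult_pos_pos[OF h(1) parameters(3)] by (intro mult_mono) linarith+
  moreover have "(1 + s') * (\<beta> * hinge' (h - \<kappa>) \<tau> s') \<le> (1 + h) * (\<beta> * 1)"
    using assms h parameters hinge'_less_1[OF parameters(4), of "h - \<kappa>" s']
      hinge'_pos[OF parameters(4), of "h - \<kappa>" s']
    by (intro mult_mono) auto
  moreover have "(1 + h) * (\<beta> * 1) < (2 - h) * (1 - h / 2)"
  proof -
    \<comment> \<open>The constant and linear terms in \<open>h\<close> cancel by the choice of
      \<open>\<beta>\<close>.\<close>
    have "(2 - h) * (1 - h / 2) - (1 + h) * (\<beta> * 1) = 9 / 2 * (h * h)"
      by (simp add: \<beta>_def field_simps)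
    then show ?thesis using h mult_pos_pos[of h h] by linarith
  qed
  ultimately show ?thesis using nodes by (simp add: marginal_def)
qed

text \<open>Left of its kink, \<open>a\<close> has a marginal cost of order \<open>h\<close>,
  whereas \<open>b\<close> is at least \<open>\<kappa>\<close> beyond its kink and has one of at
  least \<open>1 / 2\<close>.\<close>

lemma marginal_lt:
  assumes "0 \<le> s" "s \<le> 1" "s \<le> 1 - h - h * \<kappa>" "h \<le> s'"
  shows "(1 + s) * marginal a s < (1 + s') * marginal b s'"
proof -
  have "hinge' (1 - h) \<tau> s \<le> h / 2"
    using hinge'_left[OF parameters(4), of "h * \<kappa>" s "1 - h"] h parameters assms \<tau>_div by simp
  then have "(1 + s) * hinge' (1 - h) \<tau> s \<le> 2 * (h / 2)"
    using assms h hinge'_pos[OF parameters(4), of "1 - h" s] by (intro mult_mono) auto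
  moreover have "h * h \<le> 1 * 1" using h by (intro mult_mono) auto
  then have "1 / 2 \<le> hinge' (h - \<kappa>) \<tau> s'"
    using hinge'_right[OF parameters(4) parameters(3), of "h - \<kappa>" s', unfolded \<tau>_div] assms
    by linarith
  then have "1 * (1 * (1 / 2)) \<le> (1 + s') * (\<beta> * hinge' (h - \<kappa>) \<tau> s')"
    using assms h parameters by (intro mult_mono) auto
  ultimately show ?thesis using nodes h by (simp add: marginal_def)
qed

text \<open>When \<open>n\<close> moves its own supply from \<open>s n\<close> to \<open>s n + t\<close>, the price is divided by
  \<open>(1 + s n + t) / (1 + s n)\<close> while the actions of the others stay fixed.\<close>

definition deviation :: "('v \<Rightarrow> real) \<Rightarrow> 'v \<Rightarrow> real \<Rightarrow> 'v \<Rightarrow> real" where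
  "deviation s n t m = (if m = n then s n + t else 1 - (1 - s m) * (1 + s n + t) / (1 + s n))"

lemma price_M: "price M w = (w a + w b + w c) / 2"
  using c nodes by (simp add: price_def M_simps(3) demand_M sum_gens)

lemma supply_M: "supply_profile M w n = 1 - w n / price M w"
  by (simp add: supply_profile_def supply_fun_def demand_M)

lemma action_eq: "price M w > 0 \<Longrightarrow> w n = price M w * (1 - supply_profile M w n)"
  by (simp add: supply_M)

lemma supply_sum:
  assumes "price M w > 0"
  shows "supply_profile M w a + supply_profile M w b + supply_profile M w c = 1"
proof -
  have "w a + w b + w c = 2 * price M w" by (simp add: price_M)
  then have "w a / price M w + w b / price M w + w c / price M w = 2"
    using assms by (simp add: add_divide_distrib[symmetric])
  then show ?thesis by (simp add: supply_M)
qed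

context
  fixes w :: "'v \<Rightarrow> real" and n :: 'v and t :: real
  assumes p: "price M w > 0" and n: "n \<in> {a, b, c}"
    and s: "1 + supply_profile M w n > 0" and t: "1 + supply_profile M w n + t > 0"
begin

text \<open>The actions of the others sum to the price times one plus the supply of
  \<open>n\<close>, so this product stays fixed. It determines the new price, and the action is that
  price times one minus the new supply.\<close>

definition deviation_action :: real where
  "deviation_action = price M w * (1 + supply_profile M w n) * (1 - supply_profile M w n - t)
     / (1 + supply_profile M w n + t)"

lemma deviation_price:
  "price M (w(n := deviation_action))
     = price M w * (1 + supply_profile M w n) / (1 + supply_profile M w n + t)"
proof -
  define A where "A = 1 + supply_profile M w n"
  define P where "P = price M w"
  have A: "A > 0" "A + t > 0" using s t by (auto simp: A_def)
  have "w a + w b + w c = 2 * P" by (simp add: P_def price_M)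
  moreover have "w n = P * (2 - A)"
    using action_eq[OF p, of n] by (simp add: P_def A_def)
  ultimately have "price M (w(n := deviation_action)) = (P * A + deviation_action) / 2"
    using n c nodes unfolding price_M by (auto simp: algebra_simps)
  also have "\<dots> = (P * A + P * A * (2 - A - t) / (A + t)) / 2"
    by (simp add: deviation_action_def A_def P_def algebra_simps)
  also have "\<dots> = P * A / (A + t)"
    using A by (simp add: field_simps)
  finally show ?thesis by (simp add: P_def A_def)
qed

lemma deviation_supply:
  "supply_profile M (w(n := deviation_action)) = deviation (supply_profile M w) n t"
proof
  fix m
  show "supply_profile M (w(n := deviation_action)) m = deviation (supply_profile M w) n t m"
  proof (cases "m = n")
    case True
    have "supply_profile M (w(n := deviation_action)) n
        = 1 - deviation_action / (price M w * (1 + supply_profile M w n) / (1 + supply_profile M w n + t))"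
      unfolding supply_M[of "w(n := deviation_action)"] deviation_price by simp
    also have "\<dots> = supply_profile M w n + t"
      using p s t by (simp add: deviation_action_def)
    finally show ?thesis using True by (simp add: deviation_def)
  next
    case False
    then show ?thesis
      unfolding supply_M[of "w(n := deviation_action)"] deviation_price
      using p s t action_eq[OF p, of m] by (simp add: deviation_def)
  qed
qed

lemma deviation_profit:
  "profit M (w(n := deviation_action)) n
     = price M w * (1 + supply_profile M w n) * (supply_profile M w n + t)
         / (1 + supply_profile M w n + t) - cost M n (supply_profile M w n + t)"
  unfolding profit_def deviation_supply deviation_price by (simp add: deviation_def)

end

end

section \<open>Deviations under the flow limits\<close>

context tight_grid
begin

text \<open>Rate of change of \<open>ba_flow\<close> in \<open>t\<close> along
  \<open>deviation s n t\<close>; the dependence is affine.\<close>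

definition slope :: "('v \<Rightarrow> real) \<Rightarrow> 'v \<Rightarrow> real" where
  "slope s n =
    (if n = a then - ((1 - s b) * flow_b + (1 - s c) * flow_c) / (1 + s a)
     else if n = b then flow_b - flow_c * (1 - s c) / (1 + s b)
     else flow_c - flow_b * (1 - s b) / (1 + s c))"

lemma deviation_sum:
  assumes "s a + s b + s c = 1" "n \<in> {a, b, c}" "1 + s n > 0"
  shows "deviation s n t a + deviation s n t b + deviation s n t c = 1"
proof -
  have sa: "s a = 1 - s b - s c" using assms by simp
  show ?thesis
    using assms(2,3) nodes c by (auto simp: deviation_def divide_simps sa) (auto simp: algebra_simps)
qed

lemma deviation_ba_flow:
  assumes "n \<in> {a, b, c}" "1 + s n > 0"
  shows "ba_flow (deviation s n t) = ba_flow s + t * slope s n"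
  using assms nodes c
  by (auto simp: ba_flow_def deviation_def slope_def divide_simps) (auto simp: algebra_simps)

text \<open>A step of at most \<open>\<phi> / 4\<close> changes the supply of \<open>c\<close> by no
  more than that, so only the line between \<open>a\<close> and \<open>b\<close> has to be checked.
  The supply of \<open>c\<close> may become negative here, since a deviation of another supplier is
  not subject to the capacity limits of \<open>c\<close>.\<close>

lemma deviation_within:
  assumes "s a + s b + s c = 1" "n \<in> {a, b, c}" "0 \<le> s n" "0 \<le> s c" "s c \<le> \<phi> / 4"
    and t: "\<bar>t\<bar> \<le> \<phi> / 4" "\<bar>ba_flow s + t * slope s n\<bar> \<le> \<phi>"
  shows "within_flow_limits M Ag Al (deviation s n t)"
proof (rule within_flow_limitsI)
  have n: "1 + s n > 0" using assms by simp
  show "deviation s n t a + deviation s n t b + deviation s n t c = 1"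
    by (rule deviation_sum[where s = s and n = n, OF assms(1,2) n])
  show "\<bar>ba_flow (deviation s n t)\<bar> \<le> \<phi>"
    using deviation_ba_flow[where s = s and n = n, OF assms(2) n] t by simp
  show "\<bar>deviation s n t c\<bar> \<le> \<phi> / 2"
  proof (cases "n = c")
    case True
    then have "deviation s n t c = s c + t" by (simp add: deviation_def)
    then show ?thesis using assms(4,5) t(1) by linarith
  next
    case False
    have "deviation s n t c = s c - t * ((1 - s c) / (1 + s n))"
      using n False by (simp add: deviation_def divide_simps) (simp add: algebra_simps)
    moreover have "\<bar>t * ((1 - s c) / (1 + s n))\<bar> \<le> \<phi> / 4 * 1"
      unfolding abs_mult using assms parameters h by (intro mult_mono) (auto simp: abs_le_iff divide_simps)
    ultimately show ?thesis using assms(4,5) by linarith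
  qed
qed

section \<open>First-order conditions at an equilibrium\<close>

context
  fixes w assumes eq: "supply_function_equilibrium M Ag Al w"
begin

private abbreviation "s \<equiv> supply_profile M w"
private abbreviation "p \<equiv> price M w"

lemma equilibrium_arg_max:
  "n \<in> {a, b, c} \<Longrightarrow> is_arg_max (\<lambda>x. profit M (w(n := x)) n) (feasible_action M Ag Al w n) (w n)"
  using eq unfolding supply_function_equilibrium_def M_simps(3) by blast

lemma equilibrium_feasible: "n \<in> {a, b, c} \<Longrightarrow> feasible_action M Ag Al w n (w n)"
  using equilibrium_arg_max by (simp add: is_arg_max_def)

lemma equilibrium_price: "p > 0"
  using equilibrium_feasible[of a] by (simp add: feasible_action_def M_simps(3) sum_gens price_M)

lemma equilibrium_sum: "s a + s b + s c = 1"
  by (rule supply_sum[OF equilibrium_price])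

lemma equilibrium_within: "within_flow_limits M Ag Al s"
  using equilibrium_feasible[of a] by (simp add: feasible_action_def)

lemma equilibrium_bounds:
  assumes "n \<in> {a, b, c}"
  shows "0 \<le> s n" "s n \<le> smax M n" "s n \<le> 1"
  using equilibrium_feasible[OF assms] equilibrium_price
  by (simp_all add: feasible_action_def M_simps(6) supply_M)

lemma equilibrium_deviation:
  assumes "n \<in> {a, b, c}" "0 \<le> s n + t" "s n + t \<le> 1" "s n + t \<le> smax M n"
    and "within_flow_limits M Ag Al (deviation s n t)"
  shows "p * (1 + s n) * (s n + t) / (1 + s n + t) - cost M n (s n + t) \<le> p * s n - cost M n (s n)"
proof -
  have pos: "1 + s n > 0" "1 + s n + t > 0"
    using equilibrium_bounds[OF assms(1)] assms(2) by auto
  note p = equilibrium_price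
  define x where "x = deviation_action w n t"
  have x: "x \<ge> 0"
    using p pos assms(3) unfolding x_def deviation_action_def[OF p assms(1) pos]
    by (intro divide_nonneg_pos mult_nonneg_nonneg) auto
  have "price M (w(n := x)) > 0"
    unfolding x_def deviation_price[OF p assms(1) pos] using p pos by simp
  then have "(\<Sum>m\<in>gens M. (w(n := x)) m) > 0"
    unfolding M_simps(3) sum_gens price_M by simp
  moreover have "supply_profile M (w(n := x)) = deviation s n t"
    unfolding x_def by (rule deviation_supply[OF p assms(1) pos])
  moreover have "deviation s n t n = s n + t" by (simp add: deviation_def)
  ultimately have "feasible_action M Ag Al w n x"
    using assms x by (simp add: feasible_action_def M_simps(6))
  then have "profit M (w(n := x)) n \<le> profit M (w(n := w n)) n"
    using equilibrium_arg_max[OF assms(1)] by (auto simp: is_arg_max_def not_less)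
  then show ?thesis
    unfolding x_def deviation_profit[OF p assms(1) pos] by (simp add: profit_def)
qed

lemma deviation_deriv:
  assumes "n \<in> {a, b, c}"
  shows "((\<lambda>t. p * (1 + s n) * (s n + t) / (1 + s n + t) - cost M n (s n + t))
    has_real_derivative p / (1 + s n) - marginal n (s n)) (at 0)"
proof -
  have pos: "1 + s n > 0" using equilibrium_bounds[OF assms(1)] by auto
  have "((\<lambda>t. cost M n (s n + t)) has_real_derivative marginal n (s n)) (at 0)"
    using DERIV_shift[of "cost M n" "marginal n (s n)" 0 "s n"] cost_deriv[of n "s n"]
    by (simp add: add.commute)
  moreover have "((\<lambda>t. p * (1 + s n) * (s n + t) / (1 + s n + t))
      has_real_derivative p / (1 + s n)) (at 0)"
    using pos by (auto intro!: derivative_eq_intros simp: divide_simps) (auto simp: algebra_simps)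
  ultimately show ?thesis by (intro DERIV_diff)
qed

text \<open>Otherwise the profit has a positive derivative in the supply, and a small increase is
  both feasible and profitable. The flow hypotheses say that the increase does not push against a
  binding limit.\<close>

lemma first_order_up:
  assumes n: "n \<in> {a, b, c}" and "s n < 1" "s n < smax M n"
    and "ba_flow s < \<phi> \<or> slope s n \<le> 0" "- \<phi> < ba_flow s \<or> 0 \<le> slope s n" "\<bar>slope s n\<bar> \<le> 2"
  shows "p \<le> (1 + s n) * marginal n (s n)"
proof (rule ccontr)
  have pos: "1 + s n > 0" using equilibrium_bounds[OF n] by auto
  have F: "\<bar>ba_flow s\<bar> \<le> \<phi>" by (rule within_imp_ba_flow[OF equilibrium_sum equilibrium_within])
  assume "\<not> p \<le> (1 + s n) * marginal n (s n)"
  then have "p / (1 + s n) - marginal n (s n) > 0" using pos by (simp add: field_simps)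
  then obtain d where d: "d > 0" "\<And>t. 0 < t \<Longrightarrow> t < d \<Longrightarrow>
      p * s n - cost M n (s n) < p * (1 + s n) * (s n + t) / (1 + s n + t) - cost M n (s n + t)"
    using DERIV_pos_inc_right[OF deviation_deriv[OF n]] pos by auto
  obtain t0 where t0: "t0 > 0" "\<And>t. 0 < t \<Longrightarrow> t < t0 \<Longrightarrow> \<bar>ba_flow s + t * slope s n\<bar> \<le> \<phi>"
    using small_step[OF F parameters(1) assms(4-6)] by blast
  \<comment> \<open>Half of the smallest margin, so that the profit gain, the flow limit and the
    capacity are all respected.\<close>
  define t where "t = Min {d, t0, \<phi> / 4, 1 - s n, smax M n - s n} / 2"
  have "Min {d, t0, \<phi> / 4, 1 - s n, smax M n - s n} > 0"
    using d t0 parameters assms by simp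
  then have t: "t > 0" "t < d" "t < t0" "t \<le> \<phi> / 4" "t \<le> 1 - s n" "t \<le> smax M n - s n"
    unfolding t_def by (auto simp: min_def split: if_splits)
  have "within_flow_limits M Ag Al (deviation s n t)"
    using t t0(2)[of t] n equilibrium_sum equilibrium_bounds[OF n] equilibrium_bounds[of c]
    by (intro deviation_within) (auto simp: M_simps(7))
  then show False
    using equilibrium_deviation[OF n, of t] d(2)[of t] t equilibrium_bounds[OF n] by simp
qed

lemma first_order_down:
  assumes n: "n \<in> {a, b, c}" and "0 < s n"
    and "ba_flow s < \<phi> \<or> 0 \<le> slope s n" "- \<phi> < ba_flow s \<or> slope s n \<le> 0" "\<bar>slope s n\<bar> \<le> 2"
  shows "(1 + s n) * marginal n (s n) \<le> p"
proof (rule ccontr)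
  have pos: "1 + s n > 0" using equilibrium_bounds[OF n] by auto
  have F: "\<bar>ba_flow s\<bar> \<le> \<phi>" by (rule within_imp_ba_flow[OF equilibrium_sum equilibrium_within])
  assume "\<not> (1 + s n) * marginal n (s n) \<le> p"
  then have "p / (1 + s n) - marginal n (s n) < 0" using pos by (simp add: field_simps)
  then obtain d where d: "d > 0" "\<And>t. 0 < t \<Longrightarrow> t < d \<Longrightarrow>
      p * s n - cost M n (s n) < p * (1 + s n) * (s n - t) / (1 + s n - t) - cost M n (s n - t)"
    using DERIV_neg_dec_left[OF deviation_deriv[OF n]] pos by auto
  obtain t0 where t0: "t0 > 0" "\<And>t. 0 < t \<Longrightarrow> t < t0 \<Longrightarrow> \<bar>ba_flow s + t * (- slope s n)\<bar> \<le> \<phi>"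
    by (rule small_step[OF F parameters(1), of "- slope s n"]) (use assms(3-5) in auto)
  define t where "t = Min {d, t0, \<phi> / 4, s n} / 2"
  have "Min {d, t0, \<phi> / 4, s n} > 0"
    using d t0 parameters assms by simp
  then have t: "t > 0" "t < d" "t < t0" "t \<le> \<phi> / 4" "t \<le> s n"
    unfolding t_def by (auto simp: min_def split: if_splits)
  have "within_flow_limits M Ag Al (deviation s n (- t))"
    using t t0(2)[of t] n equilibrium_sum equilibrium_bounds[OF n] equilibrium_bounds[of c]
    by (intro deviation_within) (auto simp: M_simps(7))
  then show False
    using equilibrium_deviation[OF n, of "- t"] d(2)[of t] t equilibrium_bounds[OF n] by simp
qed

end

end
section \<open>Equilibria, optima and the price of anarchy\<close>

text \<open>The first-order conditions are globally sufficient: revenue is concave in the new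
  supply, and \<open>D\<close> is a subgradient of the cost. Zero supply needs only the
  inequality.\<close>

lemma best_response:
  fixes p \<sigma> \<sigma>' D :: real
  assumes "p > 0" "0 \<le> \<sigma>" "0 \<le> \<sigma>'" "C + D * (\<sigma>' - \<sigma>) \<le> C'"
    and foc: "p \<le> (1 + \<sigma>) * D" "0 < \<sigma> \<Longrightarrow> p = (1 + \<sigma>) * D"
  shows "p * (1 + \<sigma>) * \<sigma>' / (1 + \<sigma>') - C' \<le> p * \<sigma> - C"
proof -
  have "p * (1 + \<sigma>) * \<sigma>' / (1 + \<sigma>') - p * \<sigma> = p / (1 + \<sigma>') * (\<sigma>' - \<sigma>)"
    using assms(2,3) by (simp add: divide_simps) (simp add: algebra_simps)
  also have "\<dots> \<le> D * (\<sigma>' - \<sigma>)"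
  proof (cases "\<sigma> \<le> \<sigma>'")
    case True
    have "p / (1 + \<sigma>') \<le> p / (1 + \<sigma>)"
      using assms True by (intro divide_left_mono) auto
    also have "\<dots> \<le> D" using foc(1) assms(2) by (simp add: divide_simps mult.commute)
    finally show ?thesis using True by (intro mult_right_mono) auto
  next
    case False
    have "D = p / (1 + \<sigma>)" using foc(2) False assms by simp
    also have "\<dots> \<le> p / (1 + \<sigma>')"
      using assms False by (intro divide_left_mono) auto
    finally show ?thesis using False by (intro mult_right_mono_neg) auto
  qed
  finally show ?thesis using assms(4) by linarith
qed

context tight_market
begin

lemma marginal_a_bounds: "0 < marginal a s" "marginal a s < 1"
  using hinge'_pos[OF parameters(4)] hinge'_less_1[OF parameters(4)] by (auto simp: marginal_def)

lemma width: "0 < h * \<kappa>" "h * \<kappa> \<le> \<phi> / 100" "\<phi> = 2 * \<kappa>" "\<tau> \<le> \<kappa> / 100" "\<kappa> \<le> h / 12"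
proof -
  have "h * h \<le> 1 / 100 * 1" using h by (intro mult_mono) auto
  then have "h * h * \<kappa> \<le> 1 / 100 * \<kappa>" using parameters by (intro mult_right_mono) auto
  then show "\<tau> \<le> \<kappa> / 100" by (simp add: \<tau>_def)
  have "h * \<kappa> \<le> 1 / 100 * \<phi>" using h parameters by (intro mult_mono) (auto simp: \<kappa>_def)
  then show "h * \<kappa> \<le> \<phi> / 100" by simp
qed (use h parameters in \<open>auto simp: \<kappa>_def\<close>)

text \<open>Intermediate value theorem: \<open>marginal_lt\<close> and \<open>marginal_gt\<close>
  give opposite signs at the ends of an interval of radius \<open>h * \<kappa>\<close> around
  \<open>1 - h\<close>.\<close>

lemma equilibrium_point:
  obtains x where "\<bar>x - (1 - h)\<bar> \<le> h * \<kappa>" "(1 + x) * marginal a x = (2 - x) * marginal b (1 - x)"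
proof -
  define f where "f x = (1 + x) * marginal a x - (2 - x) * marginal b (1 - x)" for x
  have "continuous_on UNIV (\<lambda>x. hinge' (h - \<kappa>) \<tau> (1 - x))"
    by (rule continuous_on_compose2[OF hinge'_continuous[OF parameters(4), of UNIV]])
      (auto intro!: continuous_intros)
  then have "continuous_on UNIV f"
    unfolding f_def marginal_def using nodes
    by (auto intro!: continuous_intros hinge'_continuous parameters)
  then have cont: "continuous_on {1 - h - h * \<kappa>..1 - h + h * \<kappa>} f"
    using continuous_on_subset by blast
  have "f (1 - h - h * \<kappa>) \<le> 0" "0 \<le> f (1 - h + h * \<kappa>)"
    using marginal_lt[of "1 - h - h * \<kappa>" "h + h * \<kappa>"] marginal_gt[of "1 - h + h * \<kappa>" "h - h * \<kappa>"]
      width parameters h by (auto simp: f_def algebra_simps)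
  then obtain x where "1 - h - h * \<kappa> \<le> x" "x \<le> 1 - h + h * \<kappa>" "f x = 0"
    using IVT'[of f "1 - h - h * \<kappa>" 0 "1 - h + h * \<kappa>"] cont width by auto
  then show ?thesis by (intro that[of x]) (auto simp: f_def abs_le_iff)
qed

lemma profit_eq:
  assumes p: "price M w > 0" and n: "n \<in> {a, b, c}" and y: "price M (w(n := y)) > 0"
    and "0 \<le> supply_profile M (w(n := y)) n"
  defines "\<sigma> \<equiv> supply_profile M w n" and "\<sigma>' \<equiv> supply_profile M (w(n := y)) n"
  shows "profit M (w(n := y)) n = price M w * (1 + \<sigma>) * \<sigma>' / (1 + \<sigma>') - cost M n \<sigma>'"
proof -
  define P where "P = price M w"
  define P' where "P' = price M (w(n := y))"
  have "2 * P' = 2 * P - w n + y"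
    using n c nodes by (auto simp: P_def P'_def price_M field_simps)
  moreover have "w n = P * (1 - \<sigma>)"
    using action_eq[OF p, of n] by (simp add: P_def \<sigma>_def)
  moreover have "y = P' * (1 - \<sigma>')"
    using action_eq[OF y, of n] by (simp add: P'_def \<sigma>'_def)
  ultimately have "P' * (1 + \<sigma>') = P * (1 + \<sigma>)" by (simp add: algebra_simps)
  moreover have "1 + \<sigma>' > 0" using assms(4) by (simp add: \<sigma>'_def)
  ultimately have "P' = P * (1 + \<sigma>) / (1 + \<sigma>')" by (simp add: field_simps)
  then show ?thesis by (simp add: profit_def P'_def P_def \<sigma>'_def)
qed

section \<open>Estimates of the total cost\<close>

lemma total_cost_M: "total_cost M s = cost_a (s a) + cost_b (s b) + 4 * s c"
  using nodes c by (simp add: total_cost_def M_simps(3) sum_gens) (simp add: M_simps)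

lemma cost_ge:
  "0 \<le> cost_a x" "x - (1 - h) \<le> cost_a x"
  "0 \<le> cost_b x" "\<beta> * (x - (h - \<kappa>)) \<le> cost_b x" "x - (h - \<kappa>) \<le> cost_b x"
proof -
  show "0 \<le> cost_a x" "x - (1 - h) \<le> cost_a x"
    using hinge_nonneg[OF parameters(4)] hinge_ge[OF parameters(4)] by (auto simp: cost_a_def)
  have nn: "0 \<le> hinge (h - \<kappa>) \<tau> x" and ge: "x - (h - \<kappa>) \<le> hinge (h - \<kappa>) \<tau> x"
    using hinge_nonneg[OF parameters(4)] hinge_ge[OF parameters(4)] by auto
  show "0 \<le> cost_b x" "\<beta> * (x - (h - \<kappa>)) \<le> cost_b x"
    using nn ge parameters unfolding cost_b_def by (auto intro!: mult_left_mono mult_nonneg_nonneg)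
  show "x - (h - \<kappa>) \<le> cost_b x"
    using ge mult_right_mono[of 1 \<beta>, OF _ nn] parameters unfolding cost_b_def by linarith
qed

lemma cost_le:
  "cost_a x \<le> max 0 (x - (1 - h)) + \<tau> / 2"
  "cost_b x \<le> \<beta> * (max 0 (x - (h - \<kappa>)) + \<tau> / 2)"
  using hinge_le[OF parameters(4)] parameters
  by (auto simp: cost_a_def cost_b_def intro!: mult_left_mono)

text \<open>The marginal cost of \<open>b\<close> stays below \<open>\<beta> < 4\<close>, so letting
  \<open>b\<close> take over the supply of \<open>c\<close> does not raise the cost.\<close>

lemma cost_b_shift:
  assumes "z \<ge> 0"
  shows "cost_b (x + z) \<le> cost_b x + 4 * z"
proof -
  have "cost_b (x + z) \<le> \<beta> * (hinge (h - \<kappa>) \<tau> x + z)"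
    using hinge_lipschitz[OF parameters(4), of x "x + z"] assms parameters
    unfolding cost_b_def by (intro mult_left_mono) auto
  also have "\<dots> \<le> cost_b x + 4 * z"
    using assms h mult_right_mono[of \<beta> 4 z] by (simp add: cost_b_def \<beta>_def algebra_simps)
  finally show ?thesis .
qed

definition pair_cost :: "real \<Rightarrow> real" where
  "pair_cost x = cost_a x + cost_b (1 - x)"

text \<open>The two kinks \<open>1 - h\<close> and \<open>h - \<kappa>\<close> add up to
  \<open>1 - \<kappa>\<close>, and each excess costs at least its size.\<close>

lemma pair_cost_ge: "\<kappa> \<le> pair_cost x"
  using cost_ge(2)[of x] cost_ge(5)[of "1 - x"] by (simp add: pair_cost_def)

lemma pair_cost_near: "pair_cost (1 - h + \<kappa>) \<le> \<kappa> + 2 * \<tau>"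
proof -
  have "pair_cost (1 - h + \<kappa>) \<le> (\<kappa> + \<tau> / 2) + \<beta> * (\<tau> / 2)"
    using cost_le(1)[of "1 - h + \<kappa>"] cost_le(2)[of "1 - (1 - h + \<kappa>)"] parameters
    by (simp add: pair_cost_def)
  also have "\<beta> * (\<tau> / 2) \<le> 2 * (\<tau> / 2)"
    using h parameters by (intro mult_right_mono) (auto simp: \<beta>_def)
  finally show ?thesis using parameters by linarith
qed

lemma total_cost_ge_pair:
  assumes "s a + s b + s c = 1" "0 \<le> s c"
  shows "pair_cost (s a) \<le> total_cost M s"
proof -
  have "1 - s a = s b + s c" using assms by simp
  then show ?thesis
    using cost_b_shift[OF assms(2), of "s b"] by (simp add: pair_cost_def total_cost_M)
qed

definition pair_profile :: "real \<Rightarrow> 'v \<Rightarrow> real" where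
  "pair_profile x = (\<lambda>v. if v = a then x else if v = b then 1 - x else 0)"

lemma pair_profile: "pair_profile x a = x" "pair_profile x b = 1 - x" "pair_profile x c = 0"
  using nodes c by (auto simp: pair_profile_def)

lemma total_cost_pair: "total_cost M (pair_profile x) = pair_cost x"
  by (simp add: total_cost_M pair_profile pair_cost_def)

text \<open>A minimizer exists by compactness. Its cost is below
  \<open>2 * \<kappa> = \<phi>\<close>, which forces it so close to \<open>1 - h\<close> that the
  flow limits hold.\<close>

lemma pair_cost_minimizer:
  obtains x where "0 \<le> x" "x \<le> 1" "\<bar>x - (1 - h)\<bar> \<le> \<phi>"
    "\<And>y. 0 \<le> y \<Longrightarrow> y \<le> 1 \<Longrightarrow> pair_cost x \<le> pair_cost y"
proof -
  have hc: "continuous_on UNIV (hinge u \<tau>)" for u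
    using hinge_deriv[OF parameters(4)] DERIV_continuous_on
    by (metis has_field_derivative_at_within)
  have "continuous_on UNIV (\<lambda>x. hinge (h - \<kappa>) \<tau> (1 - x))"
    by (rule continuous_on_compose2[OF hc]) (auto intro!: continuous_intros)
  then have "continuous_on UNIV pair_cost"
    unfolding pair_cost_def[abs_def] cost_a_def cost_b_def by (intro continuous_intros hc)
  then have "continuous_on {0..1} pair_cost" using continuous_on_subset by blast
  then obtain x where x: "x \<in> {0..1}" "\<forall>y\<in>{0..1}. pair_cost x \<le> pair_cost y"
    using continuous_attains_inf[of "{0..1::real}" pair_cost] by auto
  have "pair_cost x \<le> pair_cost (1 - h + \<kappa>)"
    using x width h parameters by auto
  also have "\<dots> < 2 * \<kappa>" using pair_cost_near width parameters by linarith
  finally have "pair_cost x < 2 * \<kappa>" .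
  then have "\<bar>x - (1 - h)\<bar> \<le> \<phi>"
    using cost_ge(1,2)[of x] cost_ge(3,5)[of "1 - x"] width parameters
    unfolding pair_cost_def by linarith
  with x show ?thesis by (intro that[of x]) auto
qed

end

section \<open>Location and existence of equilibria\<close>

context tight_grid
begin

lemma pair_within:
  assumes "\<bar>x - (1 - h)\<bar> \<le> \<phi>"
  shows "within_flow_limits M Ag Al (pair_profile x)"
proof (rule within_flow_limitsI)
  have "ba_flow (pair_profile x) = - ((x - (1 - h)) * flow_b)"
    by (simp add: ba_flow_def pair_profile algebra_simps)
  then have "\<bar>ba_flow (pair_profile x)\<bar> = \<bar>x - (1 - h)\<bar> * \<bar>flow_b\<bar>"
    by (simp add: abs_mult)
  also have "\<dots> \<le> \<phi> * 1"
    using assms flow_b_le flow_b_ge h by (intro mult_mono) auto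
  finally show "\<bar>ba_flow (pair_profile x)\<bar> \<le> \<phi>" by simp
qed (use parameters in \<open>auto simp: pair_profile\<close>)

text \<open>Without congestion, \<open>a\<close> and \<open>b\<close> satisfy both first-order
  conditions, and the comparison of marginal costs locates \<open>s a\<close>. Congestion in either
  direction is excluded first.\<close>

lemma equilibrium_supply:
  assumes eq: "supply_function_equilibrium M Ag Al w"
  defines "s \<equiv> supply_profile M w"
  shows "s c = 0" "\<bar>s a - (1 - h)\<bar> \<le> h * \<kappa>" "s b = 1 - s a"
proof -
  define p where "p = price M w"
  define F where "F = ba_flow s"
  note bounds = equilibrium_bounds[OF eq, folded s_def]
  note sum = equilibrium_sum[OF eq, folded s_def]
  note up = first_order_up[OF eq, folded s_def p_def, folded F_def]
  note down = first_order_down[OF eq, folded s_def p_def, folded F_def]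
  have F: "\<bar>F\<bar> \<le> \<phi>"
    unfolding F_def s_def
    by (rule within_imp_ba_flow[OF equilibrium_sum[OF eq] equilibrium_within[OF eq]])
  have sc: "0 \<le> s c" "s c \<le> \<phi> / 4" using bounds(1,2)[of c] by (auto simp: M_simps)
  have y: "\<bar>s b - h\<bar> \<le> 2 * \<phi>"
    by (rule supply_b_bound) (use F sc parameters in \<open>auto simp: F_def\<close>)
  have sb: "h / 2 \<le> s b" "0 < s b" "s b < 1" and sa: "0 < s a" "s a < 1"
    using y h parameters sc sum by linarith+
  have smax: "smax M a = 2" "smax M b = 2" using c by (auto simp: M_simps)
  have fb: "0 < flow_b" "flow_b \<le> 1" "1 - h / 8 \<le> flow_b"
    using flow_b_le flow_b_ge h by linarith+
  note fc = flow_c_bounds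
  have slope_a: "slope s a \<le> 0" "\<bar>slope s a\<bar> \<le> 2"
  proof -
    define u where "u = (1 - s b) * flow_b + (1 - s c) * flow_c"
    have "0 \<le> u" using fb fc sb sc parameters h
      unfolding u_def by (intro add_nonneg_nonneg mult_nonneg_nonneg) linarith+
    moreover have "u \<le> (1 - s b) * 1 + (1 - s c) * 1"
      using fb fc sb sc parameters h
      unfolding u_def by (intro add_mono mult_left_mono) linarith+
    ultimately have "0 \<le> u / (1 + s a)" "u / (1 + s a) \<le> 1"
      using sa sum by (auto simp: divide_simps)
    moreover have "slope s a = - (u / (1 + s a))" by (simp add: slope_def u_def minus_divide_left)
    ultimately show "slope s a \<le> 0" "\<bar>slope s a\<bar> \<le> 2" by linarith+
  qed
  have slope_b: "0 \<le> slope s b" "\<bar>slope s b\<bar> \<le> 2"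
  proof -
    define u where "u = flow_c * (1 - s c) / (1 + s b)"
    have "0 \<le> u" using fc sb sc parameters h
      unfolding u_def by (intro divide_nonneg_pos mult_nonneg_nonneg) linarith+
    have "flow_c * (1 - s c) \<le> 1 * 1"
      using fc sc parameters h by (intro mult_mono) linarith+
    \<comment> \<open>The factor \<open>1 + s b \<ge> 1 + h / 2\<close> outweighs the loss
      \<open>h / 8\<close> in \<open>flow_b\<close>; the falling supply of \<open>c\<close> cannot
      reverse the effect of raising \<open>b\<close>.\<close>
    also have "\<dots> \<le> (1 - h / 8) * (1 + h / 2)"
    proof -
      have "(1 - h / 8) * (1 + h / 2) - 1 * 1 = h * (6 - h) / 16" by (simp add: field_simps)
      moreover have "0 \<le> h * (6 - h) / 16" using h by (intro divide_nonneg_pos mult_nonneg_nonneg) auto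
      ultimately show ?thesis by linarith
    qed
    also have "\<dots> \<le> flow_b * (1 + s b)"
      using fb sb h by (intro mult_mono) linarith+
    finally have "u \<le> flow_b" using sb by (simp add: u_def divide_simps)
    moreover have "slope s b = flow_b - u" using nodes by (simp add: slope_def u_def)
    ultimately show "0 \<le> slope s b" "\<bar>slope s b\<bar> \<le> 2" using \<open>0 \<le> u\<close> fb by auto
  qed
  have slope_c: "\<bar>slope s c\<bar> \<le> 2"
  proof -
    define u where "u = flow_b * (1 - s b) / (1 + s c)"
    have "flow_b * (1 - s b) \<le> 1 * 1" using fb sb by (intro mult_mono) linarith+
    then have "0 \<le> u" "u \<le> 1" using fb sb sc by (auto simp: u_def divide_simps)
    moreover have "slope s c = flow_c - u" using c by (simp add: slope_def u_def)
    ultimately show ?thesis using fc by auto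
  qed
  \<comment> \<open>Raising \<open>a\<close> or lowering \<open>b\<close> does not increase the flow
    from \<open>b\<close> to \<open>a\<close>, and the opposite moves do not decrease it. Each
    condition is lost only when the limit on its own side binds.\<close>
  have a_up: "p \<le> (1 + s a) * marginal a (s a)" if "- \<phi> < F"
    using up[of a] slope_a sa smax that by auto
  have a_down: "(1 + s a) * marginal a (s a) \<le> p" if "F < \<phi>"
    using down[of a] slope_a sa that by auto
  have b_up: "p \<le> (1 + s b) * marginal b (s b)" if "F < \<phi>"
    using up[of b] slope_b sb smax that by auto
  have b_down: "(1 + s b) * marginal b (s b) \<le> p" if "- \<phi> < F"
    using down[of b] slope_b sb that by auto
  have F_eq: "F = (s b - h) * flow_b + s c * flow_c" by (simp add: F_def ba_flow_def)
  have scf: "0 \<le> s c * flow_c" "s c * flow_c \<le> s c * 1"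
    using sc fc mult_left_mono[of flow_c 1 "s c"] by auto
  \<comment> \<open>At this limit \<open>b\<close> supplies at most \<open>h - \<phi>\<close>, so
    \<open>a\<close> is beyond its kink. Yet lowering \<open>a\<close> and raising \<open>b\<close>
    remain possible, which contradicts \<open>marginal_gt\<close>.\<close>
  have lower: "- \<phi> < F"
  proof (rule ccontr)
    assume "\<not> - \<phi> < F"
    then have "F = - \<phi>" using F by auto
    then have neg: "(s b - h) * flow_b \<le> - \<phi>" using F_eq scf by linarith
    have "s b - h < 0"
    proof (rule ccontr)
      assume "\<not> s b - h < 0"
      then have "0 \<le> (s b - h) * flow_b" using fb by (intro mult_nonneg_nonneg) auto
      with neg parameters show False by linarith
    qed
    then have "(s b - h) * 1 \<le> (s b - h) * flow_b" using fb by (intro mult_left_mono_neg) auto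
    from order_trans[OF this neg] have "s b \<le> h - \<phi>" by simp
    then have "(1 + s b) * marginal b (s b) < (1 + s a) * marginal a (s a)"
      using sum sc sb width parameters by (intro marginal_gt) linarith+
    moreover have "F < \<phi>" using \<open>F = - \<phi>\<close> parameters by linarith
    ultimately show False using a_down b_up by linarith
  qed
  \<comment> \<open>Here \<open>c\<close> can account for at most \<open>\<phi> / 4\<close> of the
    flow, so \<open>b\<close> exceeds \<open>h\<close> by at least \<open>3 / 4 * \<phi>\<close>.
    The moves opposite to those above now contradict \<open>marginal_lt\<close>.\<close>
  have upper: "F < \<phi>"
  proof (rule ccontr)
    assume "\<not> F < \<phi>"
    then have pos: "(s b - h) * flow_b \<ge> 3 / 4 * \<phi>" using F F_eq scf sc by linarith
    have "0 \<le> s b - h"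
    proof (rule ccontr)
      assume "\<not> 0 \<le> s b - h"
      then have "(s b - h) * flow_b \<le> 0" using fb by (intro mult_nonpos_nonneg) auto
      with pos parameters show False by linarith
    qed
    then have "(s b - h) * flow_b \<le> (s b - h) * 1" using fb by (intro mult_left_mono) auto
    from order_trans[OF pos this] have "s b \<ge> h + 3 / 4 * \<phi>" by simp
    then have "(1 + s a) * marginal a (s a) < (1 + s b) * marginal b (s b)"
      using sum sc sa width parameters by (intro marginal_lt) linarith+
    then show False using a_up[OF lower] b_down[OF lower] by linarith
  qed
  \<comment> \<open>A producing \<open>c\<close> requires a price of at least 4, but the condition
    for \<open>a\<close> keeps the price at most 2.\<close>
  show c0: "s c = 0"
  proof (rule ccontr)
    assume "s c \<noteq> 0"
    then have "(1 + s c) * marginal c (s c) \<le> p"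
      using down[of c] slope_c lower upper sc by auto
    then have "4 \<le> p" using c sc by (simp add: marginal_def)
    moreover have "(1 + s a) * marginal a (s a) \<le> 2 * 1"
      using sa marginal_a_bounds[of "s a"] by (intro mult_mono) auto
    ultimately show False using a_up[OF lower] by linarith
  qed
  show b1: "s b = 1 - s a" using sum c0 by simp
  show "\<bar>s a - (1 - h)\<bar> \<le> h * \<kappa>"
  proof (rule ccontr)
    assume "\<not> \<bar>s a - (1 - h)\<bar> \<le> h * \<kappa>"
    then consider "1 - h + h * \<kappa> \<le> s a" | "s a \<le> 1 - h - h * \<kappa>" by linarith
    then show False
    proof cases
      case 1
      then have "(1 + s b) * marginal b (s b) < (1 + s a) * marginal a (s a)"
        using b1 sb width by (intro marginal_gt) linarith+
      then show False using a_down b_up upper by fastforce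
    next
      case 2
      then have "(1 + s a) * marginal a (s a) < (1 + s b) * marginal b (s b)"
        using b1 sa width by (intro marginal_lt) linarith+
      then show False using a_up b_down lower by fastforce
    qed
  qed
qed

lemma equilibrium_exists: "\<exists>w. supply_function_equilibrium M Ag Al w"
proof -
  obtain x where x: "\<bar>x - (1 - h)\<bar> \<le> h * \<kappa>" "(1 + x) * marginal a x = (2 - x) * marginal b (1 - x)"
    using equilibrium_point .
  define p where "p = (1 + x) * marginal a x"
  \<comment> \<open>These actions sum to \<open>2 * p\<close>, so \<open>p\<close> is the price and
    \<open>pair_profile x\<close> the supply. For \<open>c\<close>, which stays at zero,
    \<open>p \<le> 4\<close> suffices.\<close>
  define w where "w v = p * (1 - pair_profile x v)" for v
  have x01: "0 < x" "x < 1" using x width h parameters by linarith+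
  have p: "0 < p" "p \<le> 2 * 1"
    using x01 marginal_a_bounds[of x] mult_mono[of "1 + x" 2 "marginal a x" 1] by (auto simp: p_def)
  have price: "price M w = p"
    by (simp add: price_M w_def pair_profile algebra_simps)
  have supplied: "supply_profile M w = pair_profile x"
    using p by (auto simp: supply_M price w_def)
  have s01: "0 \<le> pair_profile x v" "pair_profile x v \<le> 1" for v
    using x01 by (auto simp: pair_profile_def)
  have within: "within_flow_limits M Ag Al (pair_profile x)"
    using x width parameters by (intro pair_within) linarith
  show ?thesis
    unfolding supply_function_equilibrium_def
  proof (intro exI[of _ w] ballI)
    fix n assume "n \<in> gens M"
    then have n: "n \<in> {a, b, c}" by (simp add: M_simps)
    have "feasible_action M Ag Al w n (w n)"
      using within n x01 p parameters price_M[of w] price nodes c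
      by (auto simp: feasible_action_def supplied M_simps(3,6,7) sum_gens pair_profile)
        (auto simp: w_def s01 intro!: mult_nonneg_nonneg)
    moreover have "profit M (w(n := y)) n \<le> profit M (w(n := w n)) n"
      if y: "feasible_action M Ag Al w n y" for y
    proof -
      define \<sigma>' where "\<sigma>' = supply_profile M (w(n := y)) n"
      have \<sigma>': "0 \<le> \<sigma>'" using y by (simp add: feasible_action_def M_simps \<sigma>'_def)
      have "price M (w(n := y)) > 0"
        using y by (simp only: feasible_action_def M_simps(3) sum_gens price_M) simp
      then have "profit M (w(n := y)) n
          = p * (1 + pair_profile x n) * \<sigma>' / (1 + \<sigma>') - cost M n \<sigma>'"
        using profit_eq[of w n y] p n \<sigma>' by (simp add: price supplied \<sigma>'_def)
      also have "\<dots> \<le> p * pair_profile x n - cost M n (pair_profile x n)"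
      proof (rule best_response[OF p(1) s01(1) \<sigma>' cost_tangent])
        show "p \<le> (1 + pair_profile x n) * marginal n (pair_profile x n)"
          using n x p c nodes by (auto simp: pair_profile p_def) (simp add: marginal_def)
        show "p = (1 + pair_profile x n) * marginal n (pair_profile x n)" if "0 < pair_profile x n"
          using n x that by (auto simp: pair_profile p_def)
      qed
      finally show ?thesis by (simp add: profit_def price supplied)
    qed
    ultimately show "is_arg_max (\<lambda>y. profit M (w(n := y)) n) (feasible_action M Ag Al w n) (w n)"
      by (auto simp: is_arg_max_def not_less)
  qed
qed

section \<open>Social optima and the cost ratio\<close>

definition feasible_supply :: "('v \<Rightarrow> real) \<Rightarrow> bool" where
  "feasible_supply s \<longleftrightarrow> (\<Sum>n\<in>gens M. s n) = demand M \<and>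
     (\<forall>n\<in>gens M. smin M n \<le> s n \<and> s n \<le> smax M n) \<and> within_flow_limits M Ag Al s"

lemma pair_feasible:
  assumes "0 \<le> x" "x \<le> 1" "\<bar>x - (1 - h)\<bar> \<le> \<phi>"
  shows "feasible_supply (pair_profile x)"
  using assms pair_within[OF assms(3)] parameters c nodes
  by (auto simp: feasible_supply_def M_simps(3,6,7) sum_gens pair_profile demand_M)

lemma feasible_supply_cost:
  assumes "feasible_supply s"
  shows "0 \<le> s a" "s a \<le> 1" "pair_cost (s a) \<le> total_cost M s"
  using assms total_cost_ge_pair[of s] by (auto simp: feasible_supply_def M_simps(3,6) sum_gens demand_M)

lemma optimum_exists: "\<exists>s. social_optimum M Ag Al s"
proof -
  obtain x where x: "0 \<le> x" "x \<le> 1" "\<bar>x - (1 - h)\<bar> \<le> \<phi>"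
    and min: "\<And>y. 0 \<le> y \<Longrightarrow> y \<le> 1 \<Longrightarrow> pair_cost x \<le> pair_cost y"
    using pair_cost_minimizer by blast
  have "total_cost M (pair_profile x) \<le> total_cost M s" if "feasible_supply s" for s
    using min[of "s a"] feasible_supply_cost[OF that] by (simp add: total_cost_pair)
  then have "social_optimum M Ag Al (pair_profile x)"
    using pair_feasible[OF x]
    by (auto simp: social_optimum_def is_arg_min_def feasible_supply_def[symmetric] not_less)
  then show ?thesis by blast
qed

lemma optimum_cost:
  assumes "social_optimum M Ag Al s"
  shows "\<kappa> \<le> total_cost M s" "total_cost M s \<le> \<kappa> + 2 * \<tau>"
proof -
  have s: "feasible_supply s" "\<And>s'. feasible_supply s' \<Longrightarrow> total_cost M s \<le> total_cost M s'"
    using assms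
    by (auto simp: social_optimum_def is_arg_min_def feasible_supply_def[symmetric] not_less)
  show "\<kappa> \<le> total_cost M s"
    using feasible_supply_cost(3)[OF s(1)] pair_cost_ge order_trans by blast
  have "feasible_supply (pair_profile (1 - h + \<kappa>))"
    using width h parameters by (intro pair_feasible) auto
  from s(2)[OF this] show "total_cost M s \<le> \<kappa> + 2 * \<tau>"
    using pair_cost_near by (simp add: total_cost_pair)
qed

text \<open>\<open>b\<close> supplies \<open>h\<close> up to \<open>h * \<kappa>\<close>, hence
  about \<open>\<kappa>\<close> beyond its kink at slope \<open>\<beta>\<close>, while
  \<open>a\<close> exceeds its own kink by at most \<open>h * \<kappa>\<close>.\<close>

lemma equilibrium_cost:
  assumes "supply_function_equilibrium M Ag Al w"
  shows "\<beta> * ((1 - h) * \<kappa>) \<le> total_cost M (supply_profile M w)"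
    and "total_cost M (supply_profile M w) \<le> (h * \<kappa> + \<tau> / 2) + \<beta> * (\<kappa> + h * \<kappa> + \<tau> / 2)"
proof -
  define s where "s = supply_profile M w"
  note s = equilibrium_supply[OF assms, folded s_def]
  have T: "total_cost M s = cost_a (s a) + cost_b (s b)" using s by (simp add: total_cost_M)
  have "(1 - h) * \<kappa> \<le> s b - (h - \<kappa>)" using s by (simp add: algebra_simps)
  then have "\<beta> * ((1 - h) * \<kappa>) \<le> \<beta> * (s b - (h - \<kappa>))"
    using parameters by (intro mult_left_mono) auto
  then show "\<beta> * ((1 - h) * \<kappa>) \<le> total_cost M (supply_profile M w)"
    using cost_ge(1)[of "s a"] cost_ge(4)[of "s b"] T unfolding s_def by linarith
  have "cost_a (s a) \<le> h * \<kappa> + \<tau> / 2"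
    using cost_le(1)[of "s a"] s width by linarith
  moreover have "\<beta> * (max 0 (s b - (h - \<kappa>)) + \<tau> / 2) \<le> \<beta> * (\<kappa> + h * \<kappa> + \<tau> / 2)"
    using s width parameters by (intro mult_left_mono) (linarith | simp)+
  ultimately show "total_cost M (supply_profile M w)
      \<le> (h * \<kappa> + \<tau> / 2) + \<beta> * (\<kappa> + h * \<kappa> + \<tau> / 2)"
    using cost_le(2)[of "s b"] T unfolding s_def by linarith
qed

lemma price_of_anarchy_exists: "\<exists>r. is_price_of_anarchy M Ag Al r"
  using equilibrium_exists optimum_exists by (auto simp: is_price_of_anarchy_def)

lemma price_of_anarchy_bounds:
  assumes "is_price_of_anarchy M Ag Al r"
  shows "2 - 9 * h \<le> r" "r \<le> 2"
proof -
  obtain w s where w: "supply_function_equilibrium M Ag Al w" and s: "social_optimum M Ag Al s"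
    and r: "r = total_cost M (supply_profile M w) / total_cost M s"
    using assms by (auto simp: is_price_of_anarchy_def)
  define T where "T = total_cost M (supply_profile M w)"
  define opt where "opt = total_cost M s"
  note opt = optimum_cost[OF s, folded opt_def]
  note T = equilibrium_cost[OF w, folded T_def]
  have pos: "opt > 0" using opt parameters by linarith
  have "T \<le> 2 * \<kappa>"
  proof -
    have "2 * \<kappa> - ((h * \<kappa> + \<tau> / 2) + \<beta> * (\<kappa> + h * \<kappa> + \<tau> / 2))
        = \<kappa> * (h + 5 / 2 * (h * h) + 2 * (h * (h * h)))"
      by (simp add: \<beta>_def \<tau>_def field_simps)
    moreover have "0 \<le> \<kappa> * (h + 5 / 2 * (h * h) + 2 * (h * (h * h)))"
      using h parameters by (intro mult_nonneg_nonneg add_nonneg_nonneg) auto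
    ultimately show ?thesis using T(2) by linarith
  qed
  also have "\<dots> \<le> 2 * opt" using opt by simp
  finally show "r \<le> 2" using pos by (simp add: r T_def opt_def divide_simps)
  have "(2 - 9 * h) * opt \<le> (2 - 9 * h) * (\<kappa> + 2 * \<tau>)"
    using h opt by (intro mult_left_mono) auto
  also have "\<dots> \<le> \<beta> * ((1 - h) * \<kappa>)"
  proof -
    have "\<beta> * ((1 - h) * \<kappa>) - (2 - 9 * h) * (\<kappa> + 2 * \<tau>) = \<kappa> * (3 * h + 18 * (h * (h * h)))"
      by (simp add: \<beta>_def \<tau>_def algebra_simps)
    moreover have "0 \<le> \<kappa> * (3 * h + 18 * (h * (h * h)))"
      using h parameters by (intro mult_nonneg_nonneg add_nonneg_nonneg) auto
    ultimately show ?thesis by linarith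
  qed
  also have "\<dots> \<le> T" by (rule T)
  finally show "2 - 9 * h \<le> r" using pos by (simp add: r T_def opt_def pos_le_divide_eq)
qed

end

lemma network_path:
  assumes "network N E"
  obtains a b c where "{a, b} \<in> E" "c \<in> N" "c \<noteq> a" "c \<noteq> b"
proof -
  have fin: "finite N" "card N \<ge> 3" and conn: "connected_graph N E"
    using assms by (auto simp: network_def simple_graph_def)
  obtain u where u: "u \<in> N" using fin by (metis card.empty ex_in_conv not_numeral_le_zero)
  have "\<not> N \<subseteq> {u}" using fin card_mono[of "{u}" N] by auto
  then obtain v where v: "v \<in> N" "u \<noteq> v" using u by auto
  have "(u, v) \<in> {(x, y). {x, y} \<in> E}\<^sup>*"
    using conn u v by (simp add: connected_graph_def)
  \<comment> \<open>First edge of a path from \<open>u\<close> to another bus. The third bus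
    \<open>c\<close> need not be adjacent to either end.\<close>
  then obtain b where ub: "{u, b} \<in> E" using v(2) by (metis (mono_tags, lifting) case_prodD converse_rtranclE mem_Collect_eq)
  have "\<not> N \<subseteq> {u, b}"
  proof
    assume "N \<subseteq> {u, b}"
    then have "card N \<le> card {u, b}" by (intro card_mono) auto
    also have "\<dots> \<le> 2" by (simp add: card_insert_if)
    finally show False using fin by simp
  qed
  then obtain c where "c \<in> N" "c \<noteq> u" "c \<noteq> b" by auto
  with ub show ?thesis by (rule that)
qed

theorem theorem2:
  fixes N :: "'v set" and E :: "'v set set" and \<epsilon> :: real
  assumes "network N E" and "weakly_cyclic E" and "\<epsilon> > 0"
  shows "\<exists>M :: 'v market. buses M = N \<and> lines M = E \<and> valid_market M \<and>
    (\<forall>ori Ag Al P C.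
       orientation E ori \<and> shift_factors M ori Ag Al \<and> partition_choice M P C \<longrightarrow>
         strictly_feasible M Ag Al \<and>
         poa_bound M P C =
           1 + Max ((\<lambda>n. export_bound M P C n / ((real (card (gens M)) - 2) * demand M)) ` gens M) \<and>
         (\<exists>r. is_price_of_anarchy M Ag Al r) \<and>
         (\<forall>r. is_price_of_anarchy M Ag Al r \<longrightarrow> \<bar>poa_bound M P C - r\<bar> \<le> \<epsilon>))"
proof -
  obtain a b c where abc: "{a, b} \<in> E" "c \<in> N" "c \<noteq> a" "c \<noteq> b"
    using network_path[OF assms(1)] .
  \<comment> \<open>The upper bound lies in \<open>[2 - h, 2]\<close> and every price of anarchy in
    \<open>[2 - 9 * h, 2]\<close>, so they differ by at most \<open>9 * h\<close>.\<close>
  define h where "h = min (\<epsilon> / 10) (1 / 100)"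
  have h_props: "0 < h" "h \<le> 1 / 100" "10 * h \<le> \<epsilon>" using assms(3) by (auto simp: h_def)
  interpret tight_market N E a b c h
    using assms(1) abc h_props by unfold_locales
  show ?thesis
  proof (intro exI[of _ M] conjI allI impI)
    fix ori Ag Al P C
    assume *: "orientation E ori \<and> shift_factors M ori Ag Al \<and> partition_choice M P C"
    interpret tight_grid N E a b c h ori Ag Al
      using * by unfold_locales auto
    show "strictly_feasible M Ag Al" by (rule strictly_feasible_M)
    show "poa_bound M P C =
        1 + Max ((\<lambda>n. export_bound M P C n / ((real (card (gens M)) - 2) * demand M)) ` gens M)"
      using poa_bound_M[of P C] by simp
    show "\<exists>r. is_price_of_anarchy M Ag Al r" by (rule price_of_anarchy_exists)
    fix r assume "is_price_of_anarchy M Ag Al r"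
    then show "\<bar>poa_bound M P C - r\<bar> \<le> \<epsilon>"
      using price_of_anarchy_bounds[of r] poa_bound_M(1)[of P C] export_bounds[of P C] h_props by linarith
  qed (simp_all add: M_simps valid_market_M)
qed

end
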